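(* Let $\beta>0$ and $\Lambda>0$, let $L\ge1$ be an integer and set $\tau:=\beta\Lambda/(2L)$. In the setting of the Pauli-path expansion described in the context (with this $\tau$ and an arbitrary sequence $P_1,\dots,P_L$, e.g. sampled by qDRIFT from a Hamiltonian $H=\sum_j h_jP^{(j)}$ with $\Lambda=\sum_j|h_j|$), let $k$ be an integer with $k>e\beta\Lambda/2$, let $\widetilde A_L:=\sum_{\gamma:\ r(\gamma)\le k}\mathrm{coef}(\gamma)Q_L(\gamma)$, and define $\rho:=A_L/\operatorname{Tr}(A_L)$, $\widetilde\rho:=\widetilde A_L/\operatorname{Tr}(\widetilde A_L)$. Set $$\varepsilon:=e^{\beta\Lambda/2}\Big(\frac{e\beta\Lambda}{2k}\Big)^{k}.$$ If $\varepsilon<1$, then $\|\rho-\widetilde\rho\|_1\le\frac{2\varepsilon}{1-\varepsilon}$; in particular $\|\rho-\widetilde\rho\|_1\in\mathcal O\big(e^{\beta\Lambda/2}(e\beta\Lambda/(2k))^k\big)$, and for every observable $O$, $|\operatorname{Tr}[O(\rho-\widetilde\rho)]|\le\|O\|_\infty\frac{2\varepsilon}{1-\varepsilon}$.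
   Context: Pauli-path expansion. Let $n\ge1$ and $\mathcal P_n=\{I,X,Y,Z\}^{\otimes n}$. Fix $\tau>0$, an integer $L\ge1$, and a sequence $P_1,\dots,P_L$ of Hermitian operators, each of the form $\pm P$ with $P\in\mathcal P_n\setminus\{I^{\otimes n}\}$. Define $\mathcal E_t(X)=e^{-\tau P_t/2}\,X\,e^{-\tau P_t/2}$ and $A_L:=\mathcal E_L\circ\cdots\circ\mathcal E_1(\mathbb I)$. For $Q\in\mathcal P_n$: if $P_t$ anticommutes with $Q$ then $\mathcal E_t(Q)=Q$; if $P_t$ commutes with $Q$ then $\mathcal E_t(Q)=\cosh(\tau)Q-\sinh(\tau)P_tQ$, where $P_tQ=s\,Q'$ for a unique sign $s\in\{\pm1\}$ and $Q'\in\mathcal P_n$. A Pauli path is a sequence $\gamma=(Q_0,Q_1,\dots,Q_L)$ of elements of $\mathcal P_n$ with $Q_0=\mathbb I$ such that for each $t\in\{1,\dots,L\}$ exactly one of the following holds: (a) $P_t$ anticommutes with $Q_{t-1}$ and $Q_t=Q_{t-1}$ (step factor $1$); (b) $P_t$ commutes with $Q_{t-1}$ and $Q_t=Q_{t-1}$ (step factor $\cosh\tau$); (c) $P_t$ commutes with $Q_{t-1}$ and $Q_t=Q'$ where $P_tQ_{t-1}=sQ'$ (step factor $-s\sinh\tau$; this is called a non-identity update). $\mathrm{coef}(\gamma)$ is the product of the $L$ step factors, $r(\gamma)$ is the number of non-identity updates, and $Q_t(\gamma)$ denotes the $t$-th entry. Then $A_L=\sum_\gamma\mathrm{coef}(\gamma)\,Q_L(\gamma)$,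 the sum ranging over all Pauli paths. *)

theory Defs
  imports Complex_Main "Jordan_Normal_Form.Schur_Decomposition" "Jordan_Normal_Form.Char_Poly"
begin

text \<open>Single-qubit Pauli matrices indexed by 0 = I, 1 = X, 2 = Y, 3 = Z; entries at bits a, b.\<close>
definition sigma :: "nat \<Rightarrow> nat \<Rightarrow> nat \<Rightarrow> complex" where
  "sigma c a b =
     (if c = 0 then (if a = b then 1 else 0)
      else if c = 1 then (if a \<noteq> b then 1 else 0)
      else if c = 2 then (if a = 0 \<and> b = 1 then - \<i> else if a = 1 \<and> b = 0 then \<i> else 0)
      else (if a = b then (if a = 0 then 1 else -1) else 0))"

definition paulis :: "nat \<Rightarrow> (nat \<Rightarrow> nat) set" where
  "paulis n = {p. (\<forall>q<n. p q < 4) \<and> (\<forall>q\<ge>n. p q = 0)}"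

definition pauli_id :: "nat \<Rightarrow> nat" where
  "pauli_id = (\<lambda>_. 0)"

text \<open>Matrix of a Pauli string (tensor product of the single-qubit factors), dimension 2^n.\<close>
definition pmat :: "nat \<Rightarrow> (nat \<Rightarrow> nat) \<Rightarrow> complex mat" where
  "pmat n p = mat (2^n) (2^n)
     (\<lambda>(i,j). \<Prod>q<n. sigma (p q) (i div 2^q mod 2) (j div 2^q mod 2))"

definition mtrace :: "complex mat \<Rightarrow> complex" where
  "mtrace M = (\<Sum>i<dim_row M. M $$ (i,i))"

definition mexp :: "complex mat \<Rightarrow> complex mat" where
  "mexp M = mat (dim_row M) (dim_col M)
     (\<lambda>(i,j). \<Sum>k. (M ^\<^sub>m k) $$ (i,j) / of_nat (fact k))"

text \<open>Trace norm: sum of the singular values (square roots of the eigenvalues of M^* M,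
  counted with algebraic multiplicity).\<close>
definition trace_norm :: "complex mat \<Rightarrow> real" where
  "trace_norm M = sum_mset (image_mset (\<lambda>x. sqrt (Re x)) (proots (char_poly (mat_adjoint M * M))))"

definition vnorm :: "complex vec \<Rightarrow> real" where
  "vnorm v = sqrt (\<Sum>i<dim_vec v. (cmod (v $ i))^2)"

definition op_norm :: "complex mat \<Rightarrow> real" where
  "op_norm M = Sup {vnorm (M *\<^sub>v v) | v. v \<in> carrier_vec (dim_col M) \<and> vnorm v = 1}"

definition gen_mat :: "nat \<Rightarrow> (nat \<Rightarrow> real) \<Rightarrow> (nat \<Rightarrow> nat \<Rightarrow> nat) \<Rightarrow> nat \<Rightarrow> complex mat" where
  "gen_mat n sg G t = complex_of_real (sg t) \<cdot>\<^sub>m pmat n (G t)"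

definition chan :: "nat \<Rightarrow> real \<Rightarrow> (nat \<Rightarrow> real) \<Rightarrow> (nat \<Rightarrow> nat \<Rightarrow> nat) \<Rightarrow> nat \<Rightarrow> complex mat \<Rightarrow> complex mat" where
  "chan n \<tau> sg G t X =
     mexp (complex_of_real (- \<tau> / 2) \<cdot>\<^sub>m gen_mat n sg G t) * X
       * mexp (complex_of_real (- \<tau> / 2) \<cdot>\<^sub>m gen_mat n sg G t)"

fun Aop :: "nat \<Rightarrow> real \<Rightarrow> (nat \<Rightarrow> real) \<Rightarrow> (nat \<Rightarrow> nat \<Rightarrow> nat) \<Rightarrow> nat \<Rightarrow> complex mat" where
  "Aop n \<tau> sg G 0 = 1\<^sub>m (2^n)"
| "Aop n \<tau> sg G (Suc t) = chan n \<tau> sg G (Suc t) (Aop n \<tau> sg G t)"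

definition commutes :: "complex mat \<Rightarrow> complex mat \<Rightarrow> bool" where
  "commutes A B \<longleftrightarrow> A * B = B * A"

definition anticommutes :: "complex mat \<Rightarrow> complex mat \<Rightarrow> bool" where
  "anticommutes A B \<longleftrightarrow> A * B = - (B * A)"

definition step_a :: "nat \<Rightarrow> complex mat \<Rightarrow> (nat \<Rightarrow> nat) \<Rightarrow> (nat \<Rightarrow> nat) \<Rightarrow> bool" where
  "step_a n P Qp Qn \<longleftrightarrow> anticommutes P (pmat n Qp) \<and> Qn = Qp"

definition step_b :: "nat \<Rightarrow> complex mat \<Rightarrow> (nat \<Rightarrow> nat) \<Rightarrow> (nat \<Rightarrow> nat) \<Rightarrow> bool" where
  "step_b n P Qp Qn \<longleftrightarrow> commutes P (pmat n Qp) \<and> Qn = Qp"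

definition step_c :: "nat \<Rightarrow> complex mat \<Rightarrow> (nat \<Rightarrow> nat) \<Rightarrow> (nat \<Rightarrow> nat) \<Rightarrow> bool" where
  "step_c n P Qp Qn \<longleftrightarrow> commutes P (pmat n Qp) \<and>
     (\<exists>s::real. (s = 1 \<or> s = -1) \<and> P * pmat n Qp = complex_of_real s \<cdot>\<^sub>m pmat n Qn)"

definition step_sign :: "nat \<Rightarrow> complex mat \<Rightarrow> (nat \<Rightarrow> nat) \<Rightarrow> (nat \<Rightarrow> nat) \<Rightarrow> real" where
  "step_sign n P Qp Qn =
     (THE s::real. (s = 1 \<or> s = -1) \<and> P * pmat n Qp = complex_of_real s \<cdot>\<^sub>m pmat n Qn)"

definition step_factor :: "nat \<Rightarrow> real \<Rightarrow> complex mat \<Rightarrow> (nat \<Rightarrow> nat) \<Rightarrow> (nat \<Rightarrow> nat) \<Rightarrow> real" where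
  "step_factor n \<tau> P Qp Qn =
     (if step_a n P Qp Qn then 1
      else if step_b n P Qp Qn then cosh \<tau>
      else - step_sign n P Qp Qn * sinh \<tau>)"

definition pauli_path :: "nat \<Rightarrow> (nat \<Rightarrow> real) \<Rightarrow> (nat \<Rightarrow> nat \<Rightarrow> nat) \<Rightarrow> nat \<Rightarrow> (nat \<Rightarrow> nat) list \<Rightarrow> bool" where
  "pauli_path n sg G L \<gamma> \<longleftrightarrow>
     length \<gamma> = L + 1 \<and> set \<gamma> \<subseteq> paulis n \<and> \<gamma> ! 0 = pauli_id \<and>
     (\<forall>t\<in>{1..L}.
        let P = gen_mat n sg G t; Qp = \<gamma> ! (t - 1); Qn = \<gamma> ! t;
            a = step_a n P Qp Qn; b = step_b n P Qp Qn; c = step_c n P Qp Qn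
        in (a \<and> \<not> b \<and> \<not> c) \<or> (\<not> a \<and> b \<and> \<not> c) \<or> (\<not> a \<and> \<not> b \<and> c))"

definition path_coef :: "nat \<Rightarrow> real \<Rightarrow> (nat \<Rightarrow> real) \<Rightarrow> (nat \<Rightarrow> nat \<Rightarrow> nat) \<Rightarrow> nat \<Rightarrow> (nat \<Rightarrow> nat) list \<Rightarrow> real" where
  "path_coef n \<tau> sg G L \<gamma> =
     (\<Prod>t\<in>{1..L}. step_factor n \<tau> (gen_mat n sg G t) (\<gamma> ! (t - 1)) (\<gamma> ! t))"

definition path_r :: "nat \<Rightarrow> (nat \<Rightarrow> real) \<Rightarrow> (nat \<Rightarrow> nat \<Rightarrow> nat) \<Rightarrow> nat \<Rightarrow> (nat \<Rightarrow> nat) list \<Rightarrow> nat" where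
  "path_r n sg G L \<gamma> =
     card {t\<in>{1..L}. step_c n (gen_mat n sg G t) (\<gamma> ! (t - 1)) (\<gamma> ! t)}"

definition Atrunc :: "nat \<Rightarrow> real \<Rightarrow> (nat \<Rightarrow> real) \<Rightarrow> (nat \<Rightarrow> nat \<Rightarrow> nat) \<Rightarrow> nat \<Rightarrow> nat \<Rightarrow> complex mat" where
  "Atrunc n \<tau> sg G L k = mat (2^n) (2^n) (\<lambda>(i,j).
     \<Sum>\<gamma>\<in>{\<gamma>. pauli_path n sg G L \<gamma> \<and> path_r n sg G L \<gamma> \<le> k}.
        complex_of_real (path_coef n \<tau> sg G L \<gamma>) * pmat n (\<gamma> ! L) $$ (i,j))"

end

theory Submission
  imports Defs "HOL-Analysis.L2_Norm"
begin

text \<open>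
  Write \<open>x = \<beta>\<Lambda>/2 = L\<tau>\<close>, \<open>N = 2^n\<close> and let \<open>D\<close> be the sum over the discarded paths. Weighting a path with
  \<open>w\<close> per non-identity update, \<open>\<Sum> |coef| w^r \<le> (cosh \<tau> + w sinh \<tau>)^L \<le> exp (w x)\<close> for \<open>w \<ge> 1\<close>, so
  \<open>w = k/x\<close> bounds the discarded coefficients by \<open>(ex/k)^k \<le> \<epsilon>\<close>.

  The operator \<open>A = V V*\<close> is positive with determinant 1: conjugating a Pauli string \<open>R\<close> that
  anticommutes with the generator gives \<open>B R B = R\<close> for each factor \<open>B\<close> of \<open>V\<close>, hence
  \<open>det B^2 = 1\<close>. By the inequality of arithmetic and geometric means, \<open>Tr A \<ge> N\<close>.

  For a test matrix \<open>M\<close> with \<open>|M v| \<le> c |v|\<close> one has \<open>|Tr (M A)| \<le> c Tr A\<close> and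
  \<open>|Tr (M D)| \<le> c N \<epsilon>\<close>, which gives \<open>|Tr (M (\<rho> - \<rho>'))| \<le> 2 c \<epsilon> / (1 - \<epsilon>)\<close>. Both claims follow, because
  the trace norm of a matrix is \<open>Tr (U _)\<close> for some contraction \<open>U\<close>.
\<close>

section \<open>Adjoints, norms and traces\<close>

lemma mat_adjoint_eq: "mat_adjoint (A :: complex mat) = mat (dim_col A) (dim_row A) (\<lambda>(i,j). cnj (A $$ (j,i)))"
  unfolding mat_adjoint_def by (rule eq_matI) (auto simp: mat_of_rows_def)

lemma mat_adjoint_carrier [simp]:
  "(A :: complex mat) \<in> carrier_mat n m \<Longrightarrow> mat_adjoint A \<in> carrier_mat m n"
  by (auto simp: mat_adjoint_eq)

lemma mat_adjoint_index:
  "(A :: complex mat) \<in> carrier_mat n m \<Longrightarrow> i < m \<Longrightarrow> j < n \<Longrightarrow> mat_adjoint A $$ (i,j) = cnj (A $$ (j,i))"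
  by (auto simp: mat_adjoint_eq)

lemma mat_adjoint_adjoint [simp]: "mat_adjoint (mat_adjoint (A :: complex mat)) = A"
  by (rule eq_matI) (auto simp: mat_adjoint_eq)

lemma mult_mat_index:
  assumes "A \<in> carrier_mat n m" "B \<in> carrier_mat m p" "i < n" "j < p"
  shows "(A * B) $$ (i,j) = (\<Sum>k<m. A $$ (i,k) * B $$ (k,j))"
  using assms by (auto simp: scalar_prod_def lessThan_atLeast0)

lemma mult_mat_vec_index:
  assumes "A \<in> carrier_mat n m" "v \<in> carrier_vec m" "i < n"
  shows "(A *\<^sub>v v) $ i = (\<Sum>k<m. A $$ (i,k) * v $ k)"
  using assms by (auto simp: scalar_prod_def lessThan_atLeast0)

lemma mat_adjoint_mult:
  assumes A: "(A :: complex mat) \<in> carrier_mat n m" and B: "B \<in> carrier_mat m p"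
  shows "mat_adjoint (A * B) = mat_adjoint B * mat_adjoint A"
proof (rule eq_matI)
  fix i j assume "i < dim_row (mat_adjoint B * mat_adjoint A)" "j < dim_col (mat_adjoint B * mat_adjoint A)"
  hence ij: "i < p" "j < n" using A B by (auto simp: mat_adjoint_eq)
  show "mat_adjoint (A * B) $$ (i,j) = (mat_adjoint B * mat_adjoint A) $$ (i,j)"
    using ij by (simp add: mat_adjoint_index[OF mult_carrier_mat[OF A B]] mat_adjoint_index[OF A]
        mat_adjoint_index[OF B] mult_mat_index[OF A B]
        mult_mat_index[OF mat_adjoint_carrier[OF B] mat_adjoint_carrier[OF A]] mult.commute del: index_mult_mat)
qed (use A B in \<open>auto simp: mat_adjoint_eq\<close>)

lemma mat_adjoint_one [simp]: "mat_adjoint (1\<^sub>m n :: complex mat) = 1\<^sub>m n"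
  by (rule eq_matI) (auto simp: mat_adjoint_eq)

section \<open>Hermitian inner product and Euclidean norm\<close>

lemma cscalar_prod_sum:
  "v \<in> carrier_vec n \<Longrightarrow> w \<in> carrier_vec n \<Longrightarrow> (v :: complex vec) \<bullet>c w = (\<Sum>i<n. v $ i * cnj (w $ i))"
  by (auto simp: scalar_prod_def lessThan_atLeast0 intro!: sum.cong)

lemma vnorm_L2: "v \<in> carrier_vec n \<Longrightarrow> vnorm v = L2_set (\<lambda>i. cmod (v $ i)) {..<n}"
  by (auto simp: vnorm_def L2_set_def)

lemma vnorm_nonneg [simp]: "vnorm v \<ge> 0"
  by (simp add: vnorm_def sum_nonneg)

lemma cscalar_prod_self: "v \<in> carrier_vec n \<Longrightarrow> v \<bullet>c v = complex_of_real ((vnorm v)\<^sup>2)"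
  by (simp add: cscalar_prod_sum vnorm_def sum_nonneg complex_norm_square[symmetric])

lemma norm_cscalar_prod_le:
  assumes v: "v \<in> carrier_vec n" and w: "w \<in> carrier_vec n"
  shows "cmod (v \<bullet>c w) \<le> vnorm v * vnorm w"
proof -
  have "cmod (v \<bullet>c w) \<le> (\<Sum>i<n. \<bar>cmod (v $ i)\<bar> * \<bar>cmod (w $ i)\<bar>)"
    unfolding cscalar_prod_sum[OF v w] by (rule order_trans[OF norm_sum]) (simp add: norm_mult)
  also have "\<dots> \<le> vnorm v * vnorm w"
    unfolding vnorm_L2[OF v] vnorm_L2[OF w] by (rule L2_set_mult_ineq)
  finally show ?thesis .
qed

lemma vnorm_smult: "v \<in> carrier_vec n \<Longrightarrow> vnorm (c \<cdot>\<^sub>v v) = cmod c * vnorm v"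
  by (auto simp: vnorm_def norm_mult power_mult_distrib sum_distrib_left[symmetric] real_sqrt_mult)

lemma vnorm_eq_0_iff: "v \<in> carrier_vec n \<Longrightarrow> vnorm v = 0 \<longleftrightarrow> v = 0\<^sub>v n"
  by (auto simp: vnorm_def sum_nonneg_eq_0_iff intro!: eq_vecI)

lemma adjoint_cscalar_prod:
  assumes A: "(A :: complex mat) \<in> carrier_mat n m" and v: "v \<in> carrier_vec m" and w: "w \<in> carrier_vec n"
  shows "(A *\<^sub>v v) \<bullet>c w = v \<bullet>c (mat_adjoint A *\<^sub>v w)"
proof -
  have Av: "A *\<^sub>v v \<in> carrier_vec n" and Aw: "mat_adjoint A *\<^sub>v w \<in> carrier_vec m"
    using A v w by (auto intro!: mult_mat_vec_carrier)
  have "(A *\<^sub>v v) \<bullet>c w = (\<Sum>i<n. \<Sum>k<m. A $$ (i,k) * v $ k * cnj (w $ i))"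
    unfolding cscalar_prod_sum[OF Av w]
    by (intro sum.cong refl) (simp add: mult_mat_vec_index[OF A v] sum_distrib_right del: index_mult_mat_vec)
  also have "\<dots> = (\<Sum>k<m. \<Sum>i<n. A $$ (i,k) * v $ k * cnj (w $ i))"
    by (rule sum.swap)
  also have "\<dots> = v \<bullet>c (mat_adjoint A *\<^sub>v w)"
    unfolding cscalar_prod_sum[OF v Aw]
    by (intro sum.cong refl)
      (simp add: mult_mat_vec_index[OF mat_adjoint_carrier[OF A] w] mat_adjoint_index[OF A]
        sum_distrib_left ac_simps del: index_mult_mat_vec)
  finally show ?thesis .
qed

text \<open>With \<open>u = A* w\<close>, moving \<open>A\<close> across the inner product and
  Cauchy-Schwarz give |u|^2 = |<A u, w>| <= |u| |w|; cancel |u| unless it vanishes.\<close>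

lemma contraction_adjoint:
  assumes A: "A \<in> carrier_mat n m"
    and c: "\<And>v. v \<in> carrier_vec m \<Longrightarrow> vnorm (A *\<^sub>v v) \<le> vnorm v"
    and w: "w \<in> carrier_vec n"
  shows "vnorm (mat_adjoint A *\<^sub>v w) \<le> vnorm w"
proof -
  let ?u = "mat_adjoint A *\<^sub>v w"
  have u: "?u \<in> carrier_vec m" and Au: "A *\<^sub>v ?u \<in> carrier_vec n"
    using A w by (auto intro!: mult_mat_vec_carrier)
  have "complex_of_real ((vnorm ?u)\<^sup>2) = (A *\<^sub>v ?u) \<bullet>c w"
    by (simp add: adjoint_cscalar_prod[OF A u w] cscalar_prod_self[OF u])
  hence "(vnorm ?u)\<^sup>2 = cmod ((A *\<^sub>v ?u) \<bullet>c w)"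
    by (metis norm_of_real abs_of_nonneg zero_le_power2)
  also have "\<dots> \<le> vnorm ?u * vnorm w"
    using norm_cscalar_prod_le[OF Au w] mult_right_mono[OF c[OF u] vnorm_nonneg[of w]] by linarith
  finally have "vnorm ?u * vnorm ?u \<le> vnorm ?u * vnorm w" by (simp add: power2_eq_square)
  thus ?thesis
    by (cases "vnorm ?u = 0") (simp_all add: mult_le_cancel_left order_less_le)
qed

section \<open>Trace identities and trace bounds\<close>

lemma mtrace_mult:
  assumes A: "A \<in> carrier_mat n m" and B: "B \<in> carrier_mat m n"
  shows "mtrace (A * B) = (\<Sum>i<n. \<Sum>k<m. A $$ (i,k) * B $$ (k,i))"
  using A by (simp add: mtrace_def mult_mat_index[OF A B] del: index_mult_mat(1))

lemma mtrace_comm: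
  assumes A: "A \<in> carrier_mat n m" and B: "B \<in> carrier_mat m n"
  shows "mtrace (A * B) = mtrace (B * A)"
  unfolding mtrace_mult[OF A B] mtrace_mult[OF B A] by (subst sum.swap) (simp add: mult.commute)

lemma mtrace_add: "A \<in> carrier_mat n n \<Longrightarrow> B \<in> carrier_mat n n \<Longrightarrow> mtrace (A + B) = mtrace A + mtrace B"
  by (auto simp: mtrace_def sum.distrib)

lemma mtrace_minus: "A \<in> carrier_mat n n \<Longrightarrow> B \<in> carrier_mat n n \<Longrightarrow> mtrace (A - B) = mtrace A - mtrace B"
  by (auto simp: mtrace_def sum_subtractf)

lemma mtrace_smult: "A \<in> carrier_mat n n \<Longrightarrow> mtrace (c \<cdot>\<^sub>m A) = c * mtrace A"
  by (auto simp: mtrace_def sum_distrib_left)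

lemma mtrace_one: "mtrace (1\<^sub>m n) = of_nat n"
  by (simp add: mtrace_def)

lemma mtrace_mult_adjoint_self:
  assumes V: "V \<in> carrier_mat n m"
  shows "mtrace (V * mat_adjoint V) = complex_of_real (\<Sum>j<m. (vnorm (col V j))\<^sup>2)"
proof -
  have "mtrace (V * mat_adjoint V) = (\<Sum>j<m. \<Sum>i<n. V $$ (i,j) * cnj (V $$ (i,j)))"
    unfolding mtrace_mult[OF V mat_adjoint_carrier[OF V]]
    by (subst sum.swap) (simp add: mat_adjoint_index[OF V])
  also have "\<dots> = (\<Sum>j<m. complex_of_real ((vnorm (col V j))\<^sup>2))"
    using V by (intro sum.cong refl) (auto simp: vnorm_def sum_nonneg complex_norm_square[symmetric])
  finally show ?thesis by simp
qed

lemma mtrace_mult_adjoint_le: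
  assumes M: "M \<in> carrier_mat n n" and X: "X \<in> carrier_mat n m" and Y: "Y \<in> carrier_mat n m"
    and c: "\<And>v. v \<in> carrier_vec n \<Longrightarrow> vnorm (M *\<^sub>v v) \<le> c * vnorm v"
  shows "cmod (mtrace (M * (X * mat_adjoint Y))) \<le> c * (\<Sum>j<m. vnorm (col X j) * vnorm (col Y j))"
proof -
  have MX: "M * X \<in> carrier_mat n m" using M X by auto
  have "mtrace (M * (X * mat_adjoint Y)) = mtrace ((M * X) * mat_adjoint Y)"
    by (subst assoc_mult_mat[OF M X mat_adjoint_carrier[OF Y]]) simp
  also have "\<dots> = (\<Sum>j<m. (M *\<^sub>v col X j) \<bullet>c col Y j)"
    unfolding mtrace_mult[OF MX mat_adjoint_carrier[OF Y]]
  proof (subst sum.swap, intro sum.cong refl)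
    fix j assume "j \<in> {..<m}"
    hence j: "j < m" by simp
    show "(\<Sum>i<n. (M * X) $$ (i, j) * mat_adjoint Y $$ (j, i)) = (M *\<^sub>v col X j) \<bullet>c col Y j"
      using M X Y j by (subst cscalar_prod_sum[of _ n]) (auto simp: mat_adjoint_index[OF Y])
  qed
  finally have "cmod (mtrace (M * (X * mat_adjoint Y))) \<le> (\<Sum>j<m. cmod ((M *\<^sub>v col X j) \<bullet>c col Y j))"
    by (simp add: norm_sum)
  also have "\<dots> \<le> (\<Sum>j<m. c * (vnorm (col X j) * vnorm (col Y j)))"
  proof (intro sum_mono)
    fix j
    have cx: "col X j \<in> carrier_vec n" and cy: "col Y j \<in> carrier_vec n" using X Y by auto
    have "cmod ((M *\<^sub>v col X j) \<bullet>c col Y j) \<le> vnorm (M *\<^sub>v col X j) * vnorm (col Y j)"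
      by (rule norm_cscalar_prod_le[OF mult_mat_vec_carrier[OF M cx] cy])
    also have "\<dots> \<le> c * vnorm (col X j) * vnorm (col Y j)"
      by (rule mult_right_mono[OF c[OF cx] vnorm_nonneg])
    finally show "cmod ((M *\<^sub>v col X j) \<bullet>c col Y j) \<le> c * (vnorm (col X j) * vnorm (col Y j))"
      by (simp add: mult.assoc)
  qed
  finally show ?thesis by (simp add: sum_distrib_left)
qed

lemma vnorm_mult_le_op_norm:
  assumes M: "M \<in> carrier_mat n n" and v: "v \<in> carrier_vec n"
  shows "vnorm (M *\<^sub>v v) \<le> op_norm M * vnorm v"
proof (cases "vnorm v = 0")
  case True
  hence "v = 0\<^sub>v n" using vnorm_eq_0_iff[OF v] by simp
  hence "M *\<^sub>v v = 0\<^sub>v n" using M by (auto intro!: eq_vecI)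
  thus ?thesis using True vnorm_eq_0_iff[of "M *\<^sub>v v" n] by simp
next
  case False
  let ?S = "{vnorm (M *\<^sub>v u) | u. u \<in> carrier_vec (dim_col M) \<and> vnorm u = 1}"
  \<comment> \<open>A real \<open>Sup\<close> bounds its elements only if the set is bounded above.
    The sum of all entry moduli is a crude but sufficient bound, since coordinates of a unit vector
    have modulus at most 1.\<close>
  have "bdd_above ?S"
  proof (rule bdd_aboveI)
    fix x assume "x \<in> ?S"
    then obtain u where u: "u \<in> carrier_vec n" "vnorm u = 1" and x: "x = vnorm (M *\<^sub>v u)"
      using M by auto
    have Mu: "M *\<^sub>v u \<in> carrier_vec n" using M u by auto
    have ui: "cmod (u $ k) \<le> 1" if "k < n" for k
      using member_le_L2_set[of "{..<n}" k "\<lambda>i. cmod (u $ i)"] that u vnorm_L2[OF u(1)] by simp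
    have "x \<le> (\<Sum>i<n. cmod ((M *\<^sub>v u) $ i))"
      unfolding x vnorm_L2[OF Mu] by (rule L2_set_le_sum) simp
    also have "\<dots> \<le> (\<Sum>i<n. \<Sum>k<n. cmod (M $$ (i,k)))"
    proof (rule sum_mono)
      fix i assume "i \<in> {..<n}"
      hence "(M *\<^sub>v u) $ i = (\<Sum>k<n. M $$ (i,k) * u $ k)"
        by (intro mult_mat_vec_index[OF M u(1)]) simp
      thus "cmod ((M *\<^sub>v u) $ i) \<le> (\<Sum>k<n. cmod (M $$ (i,k)))"
        using ui by (auto simp: norm_mult intro!: sum_norm_le mult_left_le)
    qed
    finally show "x \<le> (\<Sum>i<n. \<Sum>k<n. cmod (M $$ (i,k)))" .
  qed
  moreover define u where "u = complex_of_real (1 / vnorm v) \<cdot>\<^sub>v v"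
  have u: "u \<in> carrier_vec n" using v by (simp add: u_def)
  have "vnorm u = 1" using False by (simp add: u_def vnorm_smult[OF v] norm_divide)
  hence "vnorm (M *\<^sub>v u) \<in> ?S" using u M by auto
  ultimately have "vnorm (M *\<^sub>v u) \<le> op_norm M"
    unfolding op_norm_def by (intro cSup_upper)
  moreover have "vnorm (M *\<^sub>v u) = vnorm (M *\<^sub>v v) / vnorm v"
    unfolding u_def mult_mat_vec[OF M v] vnorm_smult[OF mult_mat_vec_carrier[OF M v]]
    by (simp add: norm_divide)
  ultimately show ?thesis using False vnorm_nonneg[of v] by (simp add: divide_le_eq split: if_splits)
qed

section \<open>Spectral theorem and trace norm\<close>

text \<open>Trace and determinant are invariant under similarity, and the Schur form is triangular
  with the prescribed eigenvalues on its diagonal.\<close>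

lemma mtrace_det_eigenvalues:
  assumes A: "A \<in> carrier_mat n n" and es: "char_poly A = (\<Prod>a\<leftarrow>es. [:- a, 1:])"
  shows "mtrace A = sum_list es" "det A = prod_list es"
proof -
  obtain B P Q where "schur_decomposition A es = (B, P, Q)" by (cases "schur_decomposition A es")
  from schur_decomposition[OF A es this] have sim: "similar_mat_wit A B P Q"
    and ut: "upper_triangular B" and diag: "diag_mat B = es" by auto
  note w = similar_mat_witD2[OF A sim]
  have "mtrace A = mtrace (Q * (P * B))"
    unfolding w(3) by (rule mtrace_comm[where n = n and m = n]) (use w in auto)
  also have "Q * (P * B) = (Q * P) * B"
    by (rule assoc_mult_mat[symmetric]) (use w in auto)
  also have "\<dots> = B" using w by simp
  also have "mtrace B = sum_list (diag_mat B)"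
    by (simp add: mtrace_def diag_mat_def sum_list_distinct_conv_sum_set lessThan_atLeast0)
  finally show "mtrace A = sum_list es" by (simp add: diag)
  have "similar_mat A B" using sim unfolding similar_mat_def by blast
  from det_similar[OF this] det_upper_triangular[OF ut w(5)] diag show "det A = prod_list es" by simp
qed

text \<open>Deflation: shift the eigenvalues of the eigenvectors found so far to a common value \<open>R\<close>,
  chosen so that the trace forces an eigenvalue different from \<open>R\<close>; its eigenvectors
  are orthogonal to the earlier ones and hence eigenvectors of the original matrix.\<close>
lemma hermitian_orthonormal_eigenvectors:
  assumes H: "(H :: complex mat) \<in> carrier_mat n n" and herm: "mat_adjoint H = H" and "k \<le> n"
  shows "\<exists>f \<mu>. (\<forall>i<k. f i \<in> carrier_vec n \<and> H *\<^sub>v f i = \<mu> i \<cdot>\<^sub>v f i)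
     \<and> (\<forall>i<k. \<forall>j<k. f i \<bullet>c f j = (if i = j then 1 else 0))"
  using \<open>k \<le> n\<close>
proof (induction k)
  case 0
  show ?case by auto
next
  case (Suc k)
  obtain f \<mu> where f: "\<And>i. i < k \<Longrightarrow> f i \<in> carrier_vec n"
    and ev: "\<And>i. i < k \<Longrightarrow> H *\<^sub>v f i = \<mu> i \<cdot>\<^sub>v f i"
    and on: "\<And>i j. i < k \<Longrightarrow> j < k \<Longrightarrow> f i \<bullet>c f j = (if i = j then 1 else 0)"
    using Suc.IH[OF Suc_leD[OF Suc.prems]] by metis
  \<comment> \<open>The summand 1 makes Tr K - n R equal to -(n - k), which is nonzero. If all
    \<open>n\<close> eigenvalues of \<open>K\<close> were \<open>R\<close>, this difference would be
    0.\<close>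
  define R where "R = (mtrace H - (\<Sum>i<k. cnj (\<mu> i))) / of_nat (n - k) + 1"
  \<comment> \<open>The sum of (R - cnj mu_j) f_j f_j*. Conjugates are used because moving
    \<open>H\<close> across the inner product produces cnj mu_j; the argument thus never has to show
    that the eigenvalues are real.\<close>
  define E where "E = mat n n (\<lambda>(a,b). \<Sum>j<k. (R - cnj (\<mu> j)) * f j $ a * cnj (f j $ b))"
  define K where "K = H + E"
  have E: "E \<in> carrier_mat n n" by (simp add: E_def)
  have K: "K \<in> carrier_mat n n" using H E by (simp add: K_def)
  have trE: "mtrace E = (\<Sum>j<k. R - cnj (\<mu> j))"
  proof -
    have "mtrace E = (\<Sum>j<k. \<Sum>a<n. (R - cnj (\<mu> j)) * f j $ a * cnj (f j $ a))"
      unfolding mtrace_def E_def by (subst sum.swap) simp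
    also have "\<dots> = (\<Sum>j<k. (R - cnj (\<mu> j)) * (f j \<bullet>c f j))"
      using f by (intro sum.cong refl) (simp add: cscalar_prod_sum[of _ n] sum_distrib_left mult.assoc)
    finally show ?thesis using on by simp
  qed
  have "mtrace K - of_nat n * R = mtrace H - (\<Sum>i<k. cnj (\<mu> i)) - of_nat (n - k) * R"
    using mtrace_add[OF H E] trE Suc.prems by (simp add: K_def sum_subtractf of_nat_diff algebra_simps)
  also have "\<dots> = - of_nat (n - k)" using Suc.prems by (simp add: R_def field_simps)
  finally have trK: "mtrace K \<noteq> of_nat n * R" using Suc.prems by auto
  obtain es where es: "char_poly K = (\<Prod>a\<leftarrow>es. [:- a, 1:])" "length es = n"
    using char_poly_factorized[OF K] by blast
  have "\<exists>e\<in>set es. e \<noteq> R"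
  proof (rule ccontr)
    assume "\<not> ?thesis"
    hence "es = replicate n R" using es(2) by (metis replicate_eqI)
    thus False using mtrace_det_eigenvalues(1)[OF K es(1)] trK by (simp add: sum_list_replicate)
  qed
  then obtain e where e: "e \<in> set es" "e \<noteq> R" by blast
  have "eigenvalue K e"
    unfolding eigenvalue_root_char_poly[OF K] es(1) using e(1) by (auto simp: poly_prod_list prod_list_zero_iff)
  then obtain v where v: "v \<in> carrier_vec n" "v \<noteq> 0\<^sub>v n" "K *\<^sub>v v = e \<cdot>\<^sub>v v"
    using K unfolding eigenvalue_def eigenvector_def by auto
  have Kv: "(K *\<^sub>v v) $ a = (H *\<^sub>v v) $ a + (\<Sum>j<k. (R - cnj (\<mu> j)) * (v \<bullet>c f j) * f j $ a)"
    if a: "a < n" for a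
  proof -
    have "(E *\<^sub>v v) $ a = (\<Sum>b<n. \<Sum>j<k. (R - cnj (\<mu> j)) * f j $ a * cnj (f j $ b) * v $ b)"
      using a unfolding mult_mat_vec_index[OF E v(1) a] by (simp add: E_def sum_distrib_right)
    also have "\<dots> = (\<Sum>j<k. (R - cnj (\<mu> j)) * (v \<bullet>c f j) * f j $ a)"
      using f v(1) by (subst sum.swap, intro sum.cong refl)
        (simp add: cscalar_prod_sum[of _ n] sum_distrib_left sum_distrib_right ac_simps)
    finally show ?thesis
      unfolding K_def using add_mult_distrib_mat_vec[OF H E v(1)] a E H by simp
  qed
  have Hv: "H *\<^sub>v v \<in> carrier_vec n" using H v by auto
  \<comment> \<open>In <K v, f_i> the part from \<open>H\<close> contributes cnj mu_i and the part
    from \<open>E\<close> contributes R - cnj mu_i. Together they give the factor \<open>R\<close>,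
    whereas K v = e v gives \<open>e\<close>.\<close>
  have orth: "v \<bullet>c f i = 0" if i: "i < k" for i
  proof -
    have "e * (v \<bullet>c f i) = (K *\<^sub>v v) \<bullet>c f i"
      unfolding v(3) using v(1) f[OF i] by simp
    also have "\<dots> = (\<Sum>a<n. (H *\<^sub>v v) $ a * cnj (f i $ a))
        + (\<Sum>a<n. \<Sum>j<k. (R - cnj (\<mu> j)) * (v \<bullet>c f j) * (f j $ a * cnj (f i $ a)))"
      unfolding cscalar_prod_sum[OF mult_mat_vec_carrier[OF K v(1)] f[OF i]] sum.distrib[symmetric]
      by (intro sum.cong refl)
        (simp add: Kv distrib_right sum_distrib_right mult.assoc del: index_mult_mat_vec)
    also have "(\<Sum>a<n. (H *\<^sub>v v) $ a * cnj (f i $ a)) = (H *\<^sub>v v) \<bullet>c f i"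
      by (simp add: cscalar_prod_sum[OF Hv f[OF i]])
    also have "\<dots> = v \<bullet>c (\<mu> i \<cdot>\<^sub>v f i)"
      using adjoint_cscalar_prod[OF H v(1) f[OF i]] herm ev[OF i] by simp
    also have "\<dots> = cnj (\<mu> i) * (v \<bullet>c f i)"
      using v(1) f[OF i] by (simp add: cscalar_prod_sum[of _ n] sum_distrib_left ac_simps)
    also have "(\<Sum>a<n. \<Sum>j<k. (R - cnj (\<mu> j)) * (v \<bullet>c f j) * (f j $ a * cnj (f i $ a)))
        = (\<Sum>j<k. (R - cnj (\<mu> j)) * (v \<bullet>c f j) * (f j \<bullet>c f i))"
      using f i by (subst sum.swap, intro sum.cong refl)
        (simp add: cscalar_prod_sum[OF f f] sum_distrib_left)
    also have "\<dots> = (\<Sum>j<k. if j = i then (R - cnj (\<mu> j)) * (v \<bullet>c f j) else 0)"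
      using on i by (intro sum.cong refl) auto
    also have "\<dots> = (R - cnj (\<mu> i)) * (v \<bullet>c f i)" using i by simp
    finally have "(e - R) * (v \<bullet>c f i) = 0" by (simp add: algebra_simps)
    thus ?thesis using e(2) by simp
  qed
  have evH: "H *\<^sub>v v = e \<cdot>\<^sub>v v"
  proof (rule eq_vecI)
    fix a assume "a < dim_vec (e \<cdot>\<^sub>v v)"
    hence "a < n" using v by simp
    thus "(H *\<^sub>v v) $ a = (e \<cdot>\<^sub>v v) $ a" using Kv[of a] orth v(3) by simp
  qed (use H v in auto)
  have nz: "vnorm v \<noteq> 0" using v vnorm_eq_0_iff by blast
  define c where "c = complex_of_real (1 / vnorm v)"
  define u where "u = c \<cdot>\<^sub>v v"
  have u: "u \<in> carrier_vec n" using v by (simp add: u_def)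
  have "vnorm u = 1" using nz by (simp add: u_def vnorm_smult[OF v(1)] c_def norm_divide)
  hence uu: "u \<bullet>c u = 1" by (simp add: cscalar_prod_self[OF u])
  have uf: "u \<bullet>c f i = 0" if "i < k" for i
    using orth[OF that] v(1) f[OF that] by (simp add: u_def)
  have fu: "f i \<bullet>c u = 0" if "i < k" for i
  proof -
    have "f i \<bullet>c u = cnj (u \<bullet>c f i)"
      using f[OF that] u by (simp add: cscalar_prod_sum[of _ n] mult.commute)
    thus ?thesis using uf[OF that] by simp
  qed
  have Hu: "H *\<^sub>v u = e \<cdot>\<^sub>v u"
    unfolding u_def mult_mat_vec[OF H v(1)] evH by (simp add: smult_smult_assoc mult.commute)
  show ?case
    by (intro exI[of _ "f(k := u)"] exI[of _ "\<mu>(k := e)"])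
      (auto simp: less_Suc_eq f ev on u uu uf fu Hu)
qed

text \<open>The full family of \<open>n\<close> orthonormal eigenvectors, taken as the columns of
  \<open>W\<close>, gives a unitary matrix with H W = W diag(mu).\<close>

lemma hermitian_spectral:
  assumes H: "(H :: complex mat) \<in> carrier_mat n n" and herm: "mat_adjoint H = H"
  obtains W \<mu> where "W \<in> carrier_mat n n" "mat_adjoint W * W = 1\<^sub>m n" "W * mat_adjoint W = 1\<^sub>m n"
    "H = W * mat_diag n \<mu> * mat_adjoint W"
proof -
  obtain f \<mu> where f: "\<And>i. i < n \<Longrightarrow> f i \<in> carrier_vec n"
    and ev: "\<And>i. i < n \<Longrightarrow> H *\<^sub>v f i = \<mu> i \<cdot>\<^sub>v f i"
    and on: "\<And>i j. i < n \<Longrightarrow> j < n \<Longrightarrow> f i \<bullet>c f j = (if i = j then 1 else 0)"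
    using hermitian_orthonormal_eigenvectors[OF H herm order_refl] by metis
  define W where "W = mat n n (\<lambda>(a,i). f i $ a)"
  have W: "W \<in> carrier_mat n n" by (simp add: W_def)
  hence W': "mat_adjoint W \<in> carrier_mat n n" by simp
  have 1: "mat_adjoint W * W = 1\<^sub>m n"
  proof (rule eq_matI)
    fix i j assume "i < dim_row (1\<^sub>m n :: complex mat)" "j < dim_col (1\<^sub>m n :: complex mat)"
    hence ij: "i < n" "j < n" by auto
    have "(mat_adjoint W * W) $$ (i,j) = f j \<bullet>c f i"
      using ij unfolding mult_mat_index[OF W' W ij] cscalar_prod_sum[OF f f, OF ij(2,1)]
      by (intro sum.cong refl) (simp add: mat_adjoint_index[OF W], simp add: W_def)
    thus "(mat_adjoint W * W) $$ (i,j) = 1\<^sub>m n $$ (i,j)" using on ij by auto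
  qed (use W in \<open>auto simp: mat_adjoint_eq\<close>)
  have 2: "W * mat_adjoint W = 1\<^sub>m n" by (rule mat_mult_left_right_inverse[OF W' W 1])
  have colW: "col W i = f i" if "i < n" for i
    using f[OF that] that by (auto simp: W_def intro!: eq_vecI)
  have "H * W = W * mat_diag n \<mu>"
  proof (rule eq_matI)
    fix a i assume "a < dim_row (W * mat_diag n \<mu>)" "i < dim_col (W * mat_diag n \<mu>)"
    hence ai: "a < n" "i < n" using W by (auto simp: mat_diag_def)
    have "(H * W) $$ (a,i) = (H *\<^sub>v f i) $ a" using ai H W by (simp add: colW)
    thus "(H * W) $$ (a,i) = (W * mat_diag n \<mu>) $$ (a,i)"
      using ai f[of i] unfolding mat_diag_mult_right[OF W] by (simp add: ev) (simp add: W_def)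
  qed (use H W in \<open>auto simp: mat_diag_def\<close>)
  hence "H * W * mat_adjoint W = W * mat_diag n \<mu> * mat_adjoint W" by simp
  hence "H = W * mat_diag n \<mu> * mat_adjoint W"
    unfolding assoc_mult_mat[OF H W W'] 2 using H by simp
  thus ?thesis using that W 1 2 by blast
qed

text \<open>A polar decomposition in disguise. If \<open>W\<close> diagonalises M* M, the columns of
  \<open>Z = M * W\<close> are orthogonal and their lengths are the singular values. Normalising the
  nonzero columns gives a partial isometry \<open>Y\<close>, and for \<open>U = W Y*\<close> one
  gets Tr (U M) = Tr (Y* Z), the sum of the singular values.\<close>

lemma trace_norm_attained:
  assumes M: "M \<in> carrier_mat n n"
  obtains U where "U \<in> carrier_mat n n" "\<And>v. v \<in> carrier_vec n \<Longrightarrow> vnorm (U *\<^sub>v v) \<le> vnorm v"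
    "mtrace (U * M) = complex_of_real (trace_norm M)"
proof -
  let ?H = "mat_adjoint M * M"
  have M': "mat_adjoint M \<in> carrier_mat n n" using M by simp
  have H: "?H \<in> carrier_mat n n" by (rule mult_carrier_mat[OF M' M])
  have "mat_adjoint ?H = ?H" by (simp add: mat_adjoint_mult[OF M' M])
  then obtain W \<mu> where W: "W \<in> carrier_mat n n" and WW: "mat_adjoint W * W = 1\<^sub>m n"
    "W * mat_adjoint W = 1\<^sub>m n" and HW: "?H = W * mat_diag n \<mu> * mat_adjoint W"
    using hermitian_spectral[OF H] by metis
  have W': "mat_adjoint W \<in> carrier_mat n n" using W by simp
  let ?D = "mat_diag n \<mu>"
  have D: "?D \<in> carrier_mat n n" by simp
  note sq_assoc = assoc_mult_mat[of _ n n _ n _ n] mult_carrier_mat[of _ n n _ n]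
  define Z where "Z = M * W"
  have Z: "Z \<in> carrier_mat n n" and Z': "mat_adjoint Z \<in> carrier_mat n n" by (auto simp: Z_def mult_carrier_mat[OF M W])
  have ZZ: "mat_adjoint Z * Z = ?D"
  proof -
    have "mat_adjoint Z * Z = mat_adjoint W * (?H * W)"
      unfolding Z_def mat_adjoint_mult[OF M W] using M M' W W' by (simp add: sq_assoc)
    also have "\<dots> = (mat_adjoint W * W) * (?D * (mat_adjoint W * W))"
      unfolding HW using W W' D by (simp add: sq_assoc del: mat_diag_diag)
    finally show ?thesis using WW D by simp
  qed
  have mu: "\<mu> i = complex_of_real ((vnorm (col Z i))\<^sup>2)" if i: "i < n" for i
  proof -
    have "\<mu> i = (mat_adjoint Z * Z) $$ (i,i)" using i by (simp add: ZZ mat_diag_def)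
    also have "\<dots> = (\<Sum>k<n. cnj (Z $$ (k,i)) * Z $$ (k,i))"
      using i by (simp add: mult_mat_index[OF Z' Z] mat_adjoint_index[OF Z] del: index_mult_mat)
    also have "\<dots> = complex_of_real ((vnorm (col Z i))\<^sup>2)"
      using i Z by (subst cscalar_prod_self[symmetric, of _ n])
        (auto simp: cscalar_prod_sum[of _ n] mult.commute)
    finally show ?thesis .
  qed
  define s where "s i = vnorm (col Z i)" for i
  \<comment> \<open>Columns of length 0 cannot be normalised; the value 0 there makes the
    corresponding columns of \<open>Y\<close> vanish.\<close>
  define p where "p i = complex_of_real (if s i = 0 then 0 else 1 / s i)" for i
  have Dp: "mat_diag n p \<in> carrier_mat n n" by simp
  have adjp: "mat_adjoint (mat_diag n p) = mat_diag n p"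
    by (rule eq_matI) (auto simp: mat_adjoint_eq mat_diag_def p_def)
  define Y where "Y = Z * mat_diag n p"
  have Y: "Y \<in> carrier_mat n n" and Y': "mat_adjoint Y \<in> carrier_mat n n" by (auto simp: Y_def mult_carrier_mat[OF Z Dp])
  have Y'eq: "mat_adjoint Y = mat_diag n p * mat_adjoint Z"
    unfolding Y_def using mat_adjoint_mult[OF Z Dp] adjp by simp
  have "mat_adjoint Y * Y = mat_diag n p * ((mat_adjoint Z * Z) * mat_diag n p)"
    unfolding Y'eq unfolding Y_def using Z Z' Dp by (simp add: sq_assoc)
  hence YY: "mat_adjoint Y * Y = mat_diag n (\<lambda>i. p i * (\<mu> i * p i))" by (simp add: ZZ)
  \<comment> \<open>Y* Y is the diagonal projection with entries \<open>q\<close>, and a projection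
    does not increase |v|^2; hence \<open>Y\<close> is a contraction.\<close>
  define q where "q i = (if s i = 0 then 0 else 1 :: real)" for i
  have pq: "p i * (\<mu> i * p i) = complex_of_real (q i)" if "i < n" for i
    using mu[OF that] by (simp add: p_def q_def s_def power2_eq_square)
  have Yc: "vnorm (Y *\<^sub>v v) \<le> vnorm v" if v: "v \<in> carrier_vec n" for v
  proof -
    have Yv: "Y *\<^sub>v v \<in> carrier_vec n" using Y v by auto
    have "complex_of_real ((vnorm (Y *\<^sub>v v))\<^sup>2) = v \<bullet>c (mat_adjoint Y *\<^sub>v (Y *\<^sub>v v))"
      by (simp add: adjoint_cscalar_prod[OF Y v Yv, symmetric] cscalar_prod_self[OF Yv])
    also have "mat_adjoint Y *\<^sub>v (Y *\<^sub>v v) = vec n (\<lambda>i. complex_of_real (q i) * v $ i)"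
    proof -
      have "mat_adjoint Y *\<^sub>v (Y *\<^sub>v v) = mat_diag n (\<lambda>i. p i * (\<mu> i * p i)) *\<^sub>v v"
        unfolding YY[symmetric] by (rule assoc_mult_mat_vec[OF Y' Y v, symmetric])
      also have "\<dots> = vec n (\<lambda>i. complex_of_real (q i) * v $ i)"
        using v by (intro eq_vecI)
          (auto simp: mat_diag_def scalar_prod_def pq if_distrib[where f = "\<lambda>x. x * _"] cong: if_cong)
      finally show ?thesis .
    qed
    also have "v \<bullet>c \<dots> = complex_of_real (\<Sum>i<n. q i * (cmod (v $ i))\<^sup>2)"
      using v by (subst cscalar_prod_sum[of _ n])
        (auto simp: complex_norm_square ac_simps simp del: of_real_power intro!: sum.cong)
    finally have "(vnorm (Y *\<^sub>v v))\<^sup>2 = (\<Sum>i<n. q i * (cmod (v $ i))\<^sup>2)"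
      using of_real_eq_iff by blast
    also have "\<dots> \<le> (\<Sum>i<n. (cmod (v $ i))\<^sup>2)"
      by (intro sum_mono) (simp add: q_def)
    also have "\<dots> = (vnorm v)\<^sup>2" using v by (simp add: vnorm_def sum_nonneg)
    finally show ?thesis by (rule power2_le_imp_le) simp
  qed
  define U where "U = W * mat_adjoint Y"
  have U: "U \<in> carrier_mat n n" by (simp add: U_def mult_carrier_mat[OF W Y'])
  have Wc: "vnorm (W *\<^sub>v v) = vnorm v" if v: "v \<in> carrier_vec n" for v
  proof -
    have Wv: "W *\<^sub>v v \<in> carrier_vec n" using W v by auto
    have "complex_of_real ((vnorm (W *\<^sub>v v))\<^sup>2) = v \<bullet>c (mat_adjoint W *\<^sub>v (W *\<^sub>v v))"
      by (simp add: adjoint_cscalar_prod[OF W v Wv, symmetric] cscalar_prod_self[OF Wv])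
    also have "mat_adjoint W *\<^sub>v (W *\<^sub>v v) = v"
      using assoc_mult_mat_vec[OF W' W v] WW v by simp
    also have "v \<bullet>c v = complex_of_real ((vnorm v)\<^sup>2)" by (rule cscalar_prod_self[OF v])
    finally show ?thesis by (simp only: of_real_eq_iff power2_eq_iff_nonneg vnorm_nonneg)
  qed
  have Uc: "vnorm (U *\<^sub>v v) \<le> vnorm v" if v: "v \<in> carrier_vec n" for v
  proof -
    have Yv: "mat_adjoint Y *\<^sub>v v \<in> carrier_vec n" using Y' v by auto
    have "vnorm (U *\<^sub>v v) = vnorm (mat_adjoint Y *\<^sub>v v)"
      unfolding U_def assoc_mult_mat_vec[OF W Y' v] by (rule Wc[OF Yv])
    also have "\<dots> \<le> vnorm v" by (rule contraction_adjoint[OF Y Yc v])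
    finally show ?thesis .
  qed
  have "mtrace (U * M) = mtrace (mat_adjoint Y * (M * W))"
    unfolding U_def assoc_mult_mat[OF W Y' M]
    using mtrace_comm[OF W mult_carrier_mat[OF Y' M]] assoc_mult_mat[OF Y' M W] by simp
  also have "mat_adjoint Y * (M * W) = mat_diag n p * ?D"
    unfolding Y'eq Z_def[symmetric] ZZ[symmetric] using Z Z' Dp by (simp add: sq_assoc)
  also have "mtrace \<dots> = (\<Sum>i<n. complex_of_real (s i))"
    unfolding mat_diag_diag by (auto simp: mtrace_def mat_diag_def mu p_def s_def power2_eq_square intro!: sum.cong)
  also have "\<dots> = complex_of_real (trace_norm M)"
  proof -
    \<comment> \<open>Unitary similarity identifies the roots of the characteristic polynomial, with
      multiplicity, as the \<open>\<mu> i\<close>; this is the multiset in the definition of the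
      trace norm.\<close>
    have "similar_mat_wit ?H ?D W (mat_adjoint W)"
      by (rule similar_mat_witI[OF WW(2,1) HW H D W W'])
    hence "char_poly ?H = char_poly ?D" using char_poly_similar unfolding similar_mat_def by blast
    also have "\<dots> = (\<Prod>a\<leftarrow>diag_mat ?D. [:- a, 1:])"
      by (rule char_poly_upper_triangular[OF D]) (auto simp: mat_diag_def)
    also have "diag_mat ?D = map \<mu> [0..<n]" by (auto simp: diag_mat_def mat_diag_def)
    finally have "char_poly ?H = (\<Prod>a\<leftarrow>map \<mu> [0..<n]. [:- a, 1:])" .
    moreover have "proots (\<Prod>a\<leftarrow>xs. [:- a, 1:]) = mset xs" for xs :: "complex list"
      by (induction xs) (auto simp: proots_mult prod_list_zero_iff image_iff simp del: mult_pCons_left)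
    ultimately have "proots (char_poly ?H) = mset (map \<mu> [0..<n])" by (simp only:)
    hence "trace_norm M = (\<Sum>i<n. sqrt (Re (\<mu> i)))"
      by (simp add: trace_norm_def sum_unfold_sum_mset[symmetric] lessThan_atLeast0 image_mset.compositionality o_def)
    also have "\<dots> = (\<Sum>i<n. s i)" by (intro sum.cong refl) (simp add: mu s_def)
    finally show ?thesis by simp
  qed
  finally show ?thesis using that U Uc by blast
qed

text \<open>Since the trace norm is itself one of the values Tr (U M), a uniform bound over
  contractions suffices. The factor \<open>1 *\<close> matches the general operator bound
  \<open>c * vnorm v\<close> at \<open>c = 1\<close>.\<close>

lemma trace_norm_le:
  assumes M: "M \<in> carrier_mat n n"
    and c: "\<And>U. U \<in> carrier_mat n n \<Longrightarrow> (\<And>v. v \<in> carrier_vec n \<Longrightarrow> vnorm (U *\<^sub>v v) \<le> 1 * vnorm v)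
      \<Longrightarrow> cmod (mtrace (U * M)) \<le> c"
  shows "trace_norm M \<le> c"
proof -
  obtain U where "U \<in> carrier_mat n n" "\<And>v. v \<in> carrier_vec n \<Longrightarrow> vnorm (U *\<^sub>v v) \<le> vnorm v"
    "mtrace (U * M) = complex_of_real (trace_norm M)" using trace_norm_attained[OF M] by metis
  thus ?thesis using c[of U] by simp
qed

section \<open>The arithmetic-geometric mean inequality for eigenvalues\<close>

lemma ln_prod_list_le:
  fixes xs :: "real list"
  assumes "\<forall>x\<in>set xs. x > 0"
  shows "0 < prod_list xs \<and> ln (prod_list xs) \<le> sum_list xs - real (length xs)"
  using assms
proof (induction xs)
  case (Cons x xs)
  hence x: "x > 0" and IH: "0 < prod_list xs" "ln (prod_list xs) \<le> sum_list xs - real (length xs)" by auto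
  have "ln (x * prod_list xs) = ln x + ln (prod_list xs)" using x IH by (simp add: ln_mult_pos)
  moreover have "ln x \<le> x - 1" using x by (rule ln_le_minus_one)
  ultimately show ?case using x IH by simp
qed simp

text \<open>An eigenvector \<open>v\<close> of V V* has eigenvalue |V* v|^2 / |v|^2, which is
  nonnegative, and nonzero because the product of all eigenvalues is 1. Hence the eigenvalues are
  positive with geometric mean 1.\<close>

lemma mtrace_gram_ge_dim:
  assumes V: "V \<in> carrier_mat n n" and det: "det (V * mat_adjoint V) = 1"
  shows "Re (mtrace (V * mat_adjoint V)) \<ge> real n"
proof -
  let ?A = "V * mat_adjoint V"
  have V': "mat_adjoint V \<in> carrier_mat n n" and A: "?A \<in> carrier_mat n n" using V by auto
  obtain es where es: "char_poly ?A = (\<Prod>a\<leftarrow>es. [:- a, 1:])" "length es = n"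
    using char_poly_factorized[OF A] by blast
  have tr: "mtrace ?A = sum_list es" and pr: "prod_list es = 1"
    using mtrace_det_eigenvalues[OF A es(1)] det by auto
  have pos: "Re e > 0 \<and> e = complex_of_real (Re e)" if e: "e \<in> set es" for e
  proof -
    have "eigenvalue ?A e"
      unfolding eigenvalue_root_char_poly[OF A] es(1) using e by (auto simp: poly_prod_list prod_list_zero_iff)
    then obtain v where v: "v \<in> carrier_vec n" "v \<noteq> 0\<^sub>v n" "?A *\<^sub>v v = e \<cdot>\<^sub>v v"
      using A unfolding eigenvalue_def eigenvector_def by auto
    let ?u = "mat_adjoint V *\<^sub>v v"
    have u: "?u \<in> carrier_vec n" using V' v by auto
    have "e * complex_of_real ((vnorm v)\<^sup>2) = (?A *\<^sub>v v) \<bullet>c v"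
      unfolding v(3) using v(1) cscalar_prod_self[OF v(1)] by simp
    also have "\<dots> = ?u \<bullet>c ?u"
      unfolding assoc_mult_mat_vec[OF V V' v(1)] by (rule adjoint_cscalar_prod[OF V u v(1)])
    also have "\<dots> = complex_of_real ((vnorm ?u)\<^sup>2)" by (rule cscalar_prod_self[OF u])
    finally have *: "e * complex_of_real ((vnorm v)\<^sup>2) = complex_of_real ((vnorm ?u)\<^sup>2)" .
    have nz: "vnorm v \<noteq> 0" using v vnorm_eq_0_iff by blast
    have ee: "e = complex_of_real ((vnorm ?u)\<^sup>2 / (vnorm v)\<^sup>2)"
      using * nz by (simp add: field_simps)
    have "e \<noteq> 0" using pr e by (metis prod_list_zero_iff zero_neq_one)
    hence "(vnorm ?u)\<^sup>2 / (vnorm v)\<^sup>2 \<noteq> 0" using ee by auto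
    moreover have "Re e = (vnorm ?u)\<^sup>2 / (vnorm v)\<^sup>2" by (subst ee) simp
    ultimately show ?thesis using ee by (simp add: order_less_le)
  qed
  define rs where "rs = map Re es"
  have es_rs: "es = map complex_of_real rs"
    unfolding rs_def using pos by (simp add: map_idI)
  have of_real_lists: "prod_list (map complex_of_real xs) = complex_of_real (prod_list xs)"
    "sum_list (map complex_of_real xs) = complex_of_real (sum_list xs)" for xs
    by (induction xs) auto
  \<comment> \<open>The logarithm of this product is 0, so \<open>ln_prod_list_le\<close> says that
    the eigenvalues sum to at least their number.\<close>
  have "prod_list rs = 1" using pr by (simp only: es_rs of_real_lists of_real_eq_1_iff)
  hence "real (length rs) \<le> sum_list rs"
    using ln_prod_list_le[of rs] pos by (auto simp: rs_def)
  thus ?thesis using es(2) by (simp only: tr es_rs of_real_lists Re_complex_of_real length_map)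
qed

section \<open>Multiplication of Pauli strings\<close>

text \<open>For distinct non-identity Paulis \<open>c\<close>, \<open>d\<close> the product is, up to phase, the third one,
  whose index is \<open>6 - c - d\<close>.\<close>
definition pauli_dot :: "nat \<Rightarrow> nat \<Rightarrow> nat" where
  "pauli_dot c d = (if c = d then 0 else if c = 0 then d else if d = 0 then c else 6 - c - d)"

text \<open>The cyclic rule X Y = i Z, Y Z = i X, Z X = i Y; the reversed products carry -i.\<close>

definition pauli_phase :: "nat \<Rightarrow> nat \<Rightarrow> complex" where
  "pauli_phase c d = (if c = d \<or> c = 0 \<or> d = 0 then 1
     else if (c = 1 \<and> d = 2) \<or> (c = 2 \<and> d = 3) \<or> (c = 3 \<and> d = 1) then \<i> else - \<i>)"

lemma less_4_cases: "(c::nat) < 4 \<Longrightarrow> c = 0 \<or> c = 1 \<or> c = 2 \<or> c = 3"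
  by auto

lemma sigma_mult:
  assumes "c < 4" "d < 4" "a < 2" "b < 2"
  shows "sigma c a 0 * sigma d 0 b + sigma c a 1 * sigma d 1 b = pauli_phase c d * sigma (pauli_dot c d) a b"
proof -
  have "a = 0 \<or> a = 1" "b = 0 \<or> b = 1" using assms by auto
  with less_4_cases[OF assms(1)] less_4_cases[OF assms(2)] show ?thesis
    by (elim disjE; simp add: sigma_def pauli_phase_def pauli_dot_def)
qed

lemma cnj_sigma: "cnj (sigma c b a) = sigma c a b"
  by (simp add: sigma_def)

lemma pauli_dot_less: "c < 4 \<Longrightarrow> d < 4 \<Longrightarrow> pauli_dot c d < 4"
  by (auto simp: pauli_dot_def)

lemma pauli_dot_commute: "pauli_dot c d = pauli_dot d c"
  by (simp add: pauli_dot_def add.commute)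

lemma pauli_phase_swap: "c < 4 \<Longrightarrow> d < 4 \<Longrightarrow> pauli_phase d c = cnj (pauli_phase c d)"
  by (drule less_4_cases, drule less_4_cases, elim disjE) (simp_all add: pauli_phase_def)

lemma pauli_dot_eq_0: "c < 4 \<Longrightarrow> d < 4 \<Longrightarrow> pauli_dot c d = 0 \<longleftrightarrow> c = d"
  by (auto simp: pauli_dot_def)

lemma pauli_dot_eq_right: "c < 4 \<Longrightarrow> d < 4 \<Longrightarrow> pauli_dot c d = d \<longleftrightarrow> c = 0"
  by (drule less_4_cases, drule less_4_cases, elim disjE) (simp_all add: pauli_dot_def)

definition string_dot :: "(nat \<Rightarrow> nat) \<Rightarrow> (nat \<Rightarrow> nat) \<Rightarrow> nat \<Rightarrow> nat" where
  "string_dot p q = (\<lambda>i. pauli_dot (p i) (q i))"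

definition string_phase :: "nat \<Rightarrow> (nat \<Rightarrow> nat) \<Rightarrow> (nat \<Rightarrow> nat) \<Rightarrow> complex" where
  "string_phase n p q = (\<Prod>i<n. pauli_phase (p i) (q i))"

text \<open>The entry formula of \<open>pmat\<close> without bounds on the indices. Only the lowest
  \<open>n\<close> bits matter, which permits induction on the number of qubits with
  \<open>i\<close> and \<open>j\<close> held fixed.\<close>

definition string_entry :: "nat \<Rightarrow> (nat \<Rightarrow> nat) \<Rightarrow> nat \<Rightarrow> nat \<Rightarrow> complex" where
  "string_entry n p i j = (\<Prod>q<n. sigma (p q) (i div 2^q mod 2) (j div 2^q mod 2))"

lemma pmat_carrier [simp]: "pmat n p \<in> carrier_mat (2^n) (2^n)"
  by (simp add: pmat_def)

lemma pmat_dim [simp]: "dim_row (pmat n p) = 2^n" "dim_col (pmat n p) = 2^n"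
  by (simp_all add: pmat_def)

lemma pmat_index: "i < 2^n \<Longrightarrow> j < 2^n \<Longrightarrow> pmat n p $$ (i,j) = string_entry n p i j"
  by (simp add: pmat_def string_entry_def)

lemma string_entry_Suc:
  "string_entry (Suc n) p i j = string_entry n p i j * sigma (p n) (i div 2^n mod 2) (j div 2^n mod 2)"
  by (simp add: string_entry_def)

lemma low_bit_add_power:
  assumes "q < n"
  shows "(2^n + k) div 2^q mod 2 = k div 2^q mod (2::nat)"
proof -
  obtain m where "n = Suc (q + m)" using assms less_iff_Suc_add by blast
  hence "2^n + k = k + 2^q * (2 * 2^m)" by (simp add: power_add)
  thus ?thesis by (simp only: div_mult_self2) simp
qed

lemma string_entry_add_power:
  "string_entry n p (2^n + i) j = string_entry n p i j"
  "string_entry n p i (2^n + j) = string_entry n p i j"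
  by (simp_all add: string_entry_def low_bit_add_power)

lemma sum_lessThan_add: "(\<Sum>k<N + m. f k) = (\<Sum>k<N. f k) + (\<Sum>r<m. f (N + r :: nat) :: 'a :: comm_monoid_add)"
  by (induction m) (simp_all add: add.assoc)

lemma sum_lessThan_power_Suc:
  "(\<Sum>k<2 ^ Suc n. f k) = (\<Sum>k<2^n. f k) + (\<Sum>k<2^n. f (2^n + k :: nat) :: 'a :: comm_monoid_add)"
  using sum_lessThan_add[of f "2^n" "2^n"] by (simp add: mult_2)

text \<open>Splitting the summation index by its top bit leaves the lower bits unchanged, so the sum
  factors into the sum for one qubit fewer and a product of 2 by 2 Pauli matrices.\<close>

lemma string_entry_mult:
  assumes "\<And>q. q < n \<Longrightarrow> p q < 4 \<and> r q < 4"
  shows "(\<Sum>k<2^n. string_entry n p i k * string_entry n r k j)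
    = string_phase n p r * string_entry n (string_dot p r) i j"
  using assms
proof (induction n)
  case 0
  show ?case by (simp add: string_entry_def string_phase_def)
next
  case (Suc n)
  let ?a = "i div 2^n mod 2" and ?b = "j div 2^n mod 2"
  let ?S = "\<Sum>k<2^n. string_entry n p i k * string_entry n r k j"
  have "(\<Sum>k<2 ^ Suc n. string_entry (Suc n) p i k * string_entry (Suc n) r k j)
    = ?S * (sigma (p n) ?a 0 * sigma (r n) 0 ?b) + ?S * (sigma (p n) ?a 1 * sigma (r n) 1 ?b)"
    unfolding sum_lessThan_power_Suc sum_distrib_right string_entry_Suc string_entry_add_power
    by (intro arg_cong2[where f = "(+)"] sum.cong refl) (simp_all add: ac_simps)
  also have "\<dots> = ?S * (sigma (p n) ?a 0 * sigma (r n) 0 ?b + sigma (p n) ?a 1 * sigma (r n) 1 ?b)"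
    by (simp only: distrib_left)
  also have "\<dots> = ?S * (pauli_phase (p n) (r n) * sigma (string_dot p r n) ?a ?b)"
    unfolding string_dot_def using Suc.prems[of n] by (subst sigma_mult) auto
  also have "?S = string_phase n p r * string_entry n (string_dot p r) i j"
    using Suc by simp
  finally show ?case by (simp add: string_phase_def string_entry_Suc)
qed

lemma paulis_less: "p \<in> paulis n \<Longrightarrow> p q < 4"
  by (cases "q < n") (auto simp: paulis_def)

lemma string_dot_paulis: "p \<in> paulis n \<Longrightarrow> q \<in> paulis n \<Longrightarrow> string_dot p q \<in> paulis n"
  by (auto simp: paulis_def string_dot_def pauli_dot_less) (simp add: pauli_dot_def)

lemma string_dot_commute: "string_dot p q = string_dot q p"
  by (simp add: string_dot_def pauli_dot_commute)

lemma string_dot_self: "string_dot p p = pauli_id"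
  by (simp add: string_dot_def pauli_id_def pauli_dot_def)

lemma string_phase_self: "string_phase n p p = 1"
  by (simp add: string_phase_def pauli_phase_def)

lemma string_phase_swap:
  assumes p: "p \<in> paulis n" and q: "q \<in> paulis n"
  shows "string_phase n q p = cnj (string_phase n p q)"
  unfolding string_phase_def cnj_prod
  by (intro prod.cong refl pauli_phase_swap paulis_less[OF p] paulis_less[OF q])

text \<open>With \<open>string_phase_swap\<close> this gives the commutation dichotomy: swapping two
  strings conjugates the phase, so they commute if it is 1 or -1 and anticommute if it is i or
  -i.\<close>

lemma string_phase_cases: "string_phase n p q \<in> {1, -1, \<i>, -\<i>}"
proof (induction n)
  case (Suc n)
  have "pauli_phase (p n) (q n) \<in> {1, \<i>, -\<i>}" by (simp add: pauli_phase_def)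
  with Suc show ?case by (auto simp: string_phase_def)
qed (simp add: string_phase_def)

lemma pmat_mult:
  assumes p: "p \<in> paulis n" and q: "q \<in> paulis n"
  shows "pmat n p * pmat n q = string_phase n p q \<cdot>\<^sub>m pmat n (string_dot p q)"
proof (rule eq_matI)
  fix i j assume "i < dim_row (string_phase n p q \<cdot>\<^sub>m pmat n (string_dot p q))"
    "j < dim_col (string_phase n p q \<cdot>\<^sub>m pmat n (string_dot p q))"
  hence ij: "i < 2^n" "j < 2^n" by (auto simp: pmat_def)
  show "(pmat n p * pmat n q) $$ (i,j) = (string_phase n p q \<cdot>\<^sub>m pmat n (string_dot p q)) $$ (i,j)"
    using ij string_entry_mult[of n p q i j] paulis_less[OF p] paulis_less[OF q]
    unfolding mult_mat_index[OF pmat_carrier pmat_carrier ij] by (simp add: pmat_index)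
qed (auto simp: pmat_def)

lemma pmat_id: "pmat n pauli_id = 1\<^sub>m (2^n)"
proof (rule eq_matI)
  fix i j assume "i < dim_row (1\<^sub>m (2^n) :: complex mat)" "j < dim_col (1\<^sub>m (2^n) :: complex mat)"
  hence ij: "i < 2^n" "j < 2^n" by auto
  show "pmat n pauli_id $$ (i,j) = 1\<^sub>m (2^n) $$ (i,j)"
  proof (cases "i = j")
    case True
    thus ?thesis using ij by (simp add: pmat_index string_entry_def pauli_id_def sigma_def)
  next
    case False
    \<comment> \<open>Distinct indices differ in some bit, necessarily one of the lowest
      \<open>n\<close>, and there the off-diagonal entry of the single-qubit identity kills the
      product.\<close>
    then obtain q where q: "bit i q \<noteq> bit j q" using bit_eqI by blast
    have "q < n"
    proof (rule ccontr)
      assume "\<not> q < n"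
      hence "(2::nat)^n \<le> 2^q" by simp
      hence "i < 2^q" "j < 2^q" using ij by linarith+
      hence "i div 2^q = 0" "j div 2^q = 0" by auto
      thus False using q by (simp add: bit_iff_odd)
    qed
    moreover have "i div 2^q mod 2 \<noteq> j div 2^q mod 2"
      using q by (auto simp: bit_iff_odd odd_iff_mod_2_eq_one)
    ultimately have "string_entry n pauli_id i j = 0"
      by (auto simp: string_entry_def pauli_id_def sigma_def)
    thus ?thesis using ij False by (simp add: pmat_index)
  qed
qed (auto simp: pmat_def)

lemma pmat_adjoint: "mat_adjoint (pmat n p) = pmat n p"
proof (rule eq_matI)
  fix i j assume "i < dim_row (pmat n p)" "j < dim_col (pmat n p)"
  hence ij: "i < 2^n" "j < 2^n" by (auto simp: pmat_def)
  thus "mat_adjoint (pmat n p) $$ (i,j) = pmat n p $$ (i,j)"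
    by (simp add: mat_adjoint_index[OF pmat_carrier] pmat_index string_entry_def cnj_sigma)
qed (auto simp: pmat_def mat_adjoint_eq)

lemma pmat_square: "p \<in> paulis n \<Longrightarrow> pmat n p * pmat n p = 1\<^sub>m (2^n)"
  by (auto simp: pmat_mult string_phase_self string_dot_self pmat_id intro!: eq_matI)

section \<open>Trace orthogonality and anticommuting partners\<close>

lemma string_entry_trace:
  "(\<And>q. q < n \<Longrightarrow> p q < 4) \<Longrightarrow>
    (\<Sum>i<2^n. string_entry n p i i) = (\<Prod>q<n. if p q = 0 then 2 else 0)"
proof (induction n)
  case 0
  show ?case by (simp add: string_entry_def)
next
  case (Suc n)
  have "(\<Sum>i<2^Suc n. string_entry (Suc n) p i i)
     = (\<Sum>i<2^n. string_entry n p i i) * (sigma (p n) 0 0 + sigma (p n) 1 1)"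
    unfolding sum_lessThan_power_Suc distrib_left sum_distrib_right string_entry_Suc string_entry_add_power
    by (intro arg_cong2[where f = "(+)"] sum.cong refl) simp_all
  also have "sigma (p n) 0 0 + sigma (p n) 1 1 = (if p n = 0 then 2 else 0)"
    using Suc.prems[of n] by (auto simp: sigma_def)
  finally show ?case using Suc by simp
qed

text \<open>The trace is multiplicative over tensor factors, and X, Y, Z are traceless.\<close>

lemma mtrace_pmat_zero:
  assumes p: "p \<in> paulis n" and "p \<noteq> pauli_id"
  shows "mtrace (pmat n p) = 0"
proof -
  have "\<exists>q<n. p q \<noteq> 0"
  proof (rule ccontr)
    assume "\<not> ?thesis"
    hence "p q = 0" for q using p by (cases "q < n") (auto simp: paulis_def)
    thus False using assms(2) by (auto simp: pauli_id_def)
  qed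
  then obtain q where "q < n" "p q \<noteq> 0" by blast
  hence "(\<Prod>q<n. if p q = 0 then 2 else 0 :: complex) = 0" by auto
  moreover have "mtrace (pmat n p) = (\<Sum>i<2^n. string_entry n p i i)"
    by (simp add: mtrace_def pmat_index)
  ultimately show ?thesis using string_entry_trace[of n p] paulis_less[OF p] by simp
qed

text \<open>Orthogonality of distinct strings under the trace form: multiplying by the first string
  and taking traces yields a 2^n = b Tr (P Q) = 0. This makes the string reached by a non-identity
  update unique.\<close>

lemma pmat_eq_smult_imp_eq:
  assumes p: "p \<in> paulis n" and q: "q \<in> paulis n" and eq: "a \<cdot>\<^sub>m pmat n p = b \<cdot>\<^sub>m pmat n q" and a: "a \<noteq> 0"
  shows "p = q"
proof (rule ccontr)
  assume ne: "p \<noteq> q"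
  have "string_dot p q \<noteq> pauli_id"
  proof
    assume "string_dot p q = pauli_id"
    hence "pauli_dot (p i) (q i) = 0" for i by (metis string_dot_def pauli_id_def)
    hence "p i = q i" for i using pauli_dot_eq_0[OF paulis_less[OF p] paulis_less[OF q]] by blast
    thus False using ne by auto
  qed
  hence "mtrace (pmat n (string_dot p q)) = 0" by (rule mtrace_pmat_zero[OF string_dot_paulis[OF p q]])
  hence 0: "mtrace (pmat n p * pmat n q) = 0"
    by (simp add: pmat_mult[OF p q] mtrace_smult[OF pmat_carrier])
  have "pmat n p * (a \<cdot>\<^sub>m pmat n p) = pmat n p * (b \<cdot>\<^sub>m pmat n q)" by (simp add: eq)
  hence "a \<cdot>\<^sub>m (pmat n p * pmat n p) = b \<cdot>\<^sub>m (pmat n p * pmat n q)"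
    by (simp only: mult_smult_distrib[OF pmat_carrier pmat_carrier])
  hence "mtrace (a \<cdot>\<^sub>m (pmat n p * pmat n p)) = mtrace (b \<cdot>\<^sub>m (pmat n p * pmat n q))" by simp
  hence "a * of_nat (2^n) = b * mtrace (pmat n p * pmat n q)"
    unfolding pmat_square[OF p]
    by (simp add: mtrace_smult[OF mult_carrier_mat[OF pmat_carrier pmat_carrier]]
        mtrace_smult[OF one_carrier_mat] mtrace_one)
  thus False using 0 a by simp
qed

text \<open>The squared column norm is a diagonal entry of P* P = P^2, the identity.\<close>

lemma vnorm_col_pmat:
  assumes p: "p \<in> paulis n" and j: "j < 2^n"
  shows "vnorm (col (pmat n p) j) = 1"
proof -
  have c: "col (pmat n p) j \<in> carrier_vec (2^n)" by (rule carrier_vecI) simp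
  have "complex_of_real ((vnorm (col (pmat n p) j))\<^sup>2) = (\<Sum>i<2^n. cnj (pmat n p $$ (i,j)) * pmat n p $$ (i,j))"
    unfolding cscalar_prod_self[OF c, symmetric] cscalar_prod_sum[OF c c]
    using j by (auto simp: mult.commute intro!: sum.cong)
  also have "\<dots> = (mat_adjoint (pmat n p) * pmat n p) $$ (j,j)"
    unfolding mult_mat_index[OF mat_adjoint_carrier[OF pmat_carrier] pmat_carrier j j]
    using j by (simp add: mat_adjoint_index[OF pmat_carrier])
  also have "\<dots> = 1" using j by (simp add: pmat_adjoint pmat_square[OF p])
  finally have "(vnorm (col (pmat n p) j))\<^sup>2 = 1" using of_real_eq_1_iff by blast
  thus ?thesis using vnorm_nonneg[of "col (pmat n p) j"] by (simp add: power2_eq_1_iff)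
qed

lemma exists_anticommuting_string:
  assumes p: "p \<in> paulis n" and "p \<noteq> pauli_id"
  obtains r where "r \<in> paulis n" "pmat n r * pmat n p = (-1) \<cdot>\<^sub>m (pmat n p * pmat n r)"
proof -
  obtain j where j: "p j \<noteq> 0" using assms(2) by (auto simp: pauli_id_def)
  hence jn: "j < n" using p by (metis (mono_tags, lifting) mem_Collect_eq not_le paulis_def)
  \<comment> \<open>A non-identity Pauli different from the one at site \<open>j\<close>: Y if that
    is X, and X otherwise. Placed alone at \<open>j\<close>, it makes the total phase i or
    -i.\<close>
  define c where "c = (if p j = 1 then 2 else 1 :: nat)"
  define r where "r = (\<lambda>i. if i = j then c else 0)"
  have r: "r \<in> paulis n" using jn by (auto simp: paulis_def r_def c_def)
  have "string_phase n p r = (\<Prod>i<n. if i = j then pauli_phase (p j) c else 1)"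
    unfolding string_phase_def r_def by (intro prod.cong refl) (simp add: pauli_phase_def)
  also have "\<dots> = pauli_phase (p j) c" using jn by simp
  also have "\<dots> \<in> {\<i>, -\<i>}" using j by (auto simp: c_def pauli_phase_def)
  finally have "cnj (string_phase n p r) = - string_phase n p r" by auto
  hence "pmat n r * pmat n p = (-1) \<cdot>\<^sub>m (pmat n p * pmat n r)"
    unfolding pmat_mult[OF r p] pmat_mult[OF p r] string_phase_swap[OF p r] string_dot_commute[of r p]
    by (auto intro!: eq_matI)
  thus ?thesis using that r by blast
qed

section \<open>The imaginary-time evolution of a Pauli string\<close>

text \<open>Even powers of \<open>c P\<close> are multiples of the identity and odd ones multiples
  of \<open>P\<close>, so the exponential series splits into those of cosh and sinh.\<close>

lemma mexp_involution:
  assumes P: "P \<in> carrier_mat N N" and PP: "P * P = 1\<^sub>m N"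
  shows "mexp (c \<cdot>\<^sub>m P) = cosh c \<cdot>\<^sub>m 1\<^sub>m N + sinh c \<cdot>\<^sub>m P"
proof (rule eq_matI)
  have pow: "(c \<cdot>\<^sub>m P) ^\<^sub>m k = c ^ k \<cdot>\<^sub>m (if even k then 1\<^sub>m N else P)" for k
  proof (induction k)
    case 0
    show ?case using P by (auto intro!: eq_matI)
  next
    case (Suc k)
    have X: "(if even k then 1\<^sub>m N else P) \<in> carrier_mat N N" using P by simp
    have "(c \<cdot>\<^sub>m P) ^\<^sub>m Suc k = (c ^ k \<cdot>\<^sub>m (if even k then 1\<^sub>m N else P)) * (c \<cdot>\<^sub>m P)"
      by (simp add: Suc)
    also have "\<dots> = c ^ k \<cdot>\<^sub>m (c \<cdot>\<^sub>m ((if even k then 1\<^sub>m N else P) * P))"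
      by (subst mult_smult_assoc_mat[OF X smult_carrier_mat[OF P]], subst mult_smult_distrib[OF X P]) simp
    also have "(if even k then 1\<^sub>m N else P) * P = (if even (Suc k) then 1\<^sub>m N else P)"
      using P PP by simp
    also have "c ^ k \<cdot>\<^sub>m (c \<cdot>\<^sub>m (if even (Suc k) then 1\<^sub>m N else P))
        = c ^ Suc k \<cdot>\<^sub>m (if even (Suc k) then 1\<^sub>m N else P)"
      by (rule eq_matI) auto
    finally show ?case .
  qed
  fix i j assume "i < dim_row (cosh c \<cdot>\<^sub>m 1\<^sub>m N + sinh c \<cdot>\<^sub>m P)" "j < dim_col (cosh c \<cdot>\<^sub>m 1\<^sub>m N + sinh c \<cdot>\<^sub>m P)"
  hence ij: "i < N" "j < N" using P by auto
  have "(\<lambda>k. (if even k then c ^ k /\<^sub>R fact k else 0) * 1\<^sub>m N $$ (i,j)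
      + (if even k then 0 else c ^ k /\<^sub>R fact k) * P $$ (i,j))
    sums (cosh c * 1\<^sub>m N $$ (i,j) + sinh c * P $$ (i,j))"
    by (intro sums_add sums_mult2 cosh_converges sinh_converges)
  also have "(\<lambda>k. (if even k then c ^ k /\<^sub>R fact k else 0) * 1\<^sub>m N $$ (i,j)
      + (if even k then 0 else c ^ k /\<^sub>R fact k) * P $$ (i,j))
    = (\<lambda>k. ((c \<cdot>\<^sub>m P) ^\<^sub>m k) $$ (i,j) / of_nat (fact k))"
    using ij P by (auto simp: pow fun_eq_iff scaleR_conv_of_real field_simps)
  finally show "mexp (c \<cdot>\<^sub>m P) $$ (i,j) = (cosh c \<cdot>\<^sub>m 1\<^sub>m N + sinh c \<cdot>\<^sub>m P) $$ (i,j)"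
    using ij P by (simp add: mexp_def sums_iff)
qed (use P in \<open>auto simp: mexp_def\<close>)

text \<open>Everything reduces to P Q P = e Q. Commuting (\<open>e = 1\<close>) and anticommuting
  (\<open>e = -1\<close>) operators are then treated by one formula.\<close>

lemma conjugate_by_involution_combination:
  fixes a b e :: complex
  assumes P: "P \<in> carrier_mat N N" and PP: "P * P = 1\<^sub>m N" and Q: "Q \<in> carrier_mat N N"
    and QP: "Q * P = e \<cdot>\<^sub>m (P * Q)"
  defines "B \<equiv> a \<cdot>\<^sub>m 1\<^sub>m N + b \<cdot>\<^sub>m P"
  shows "B * Q * B = (a * a + e * b * b) \<cdot>\<^sub>m Q + (a * b * (1 + e)) \<cdot>\<^sub>m (P * Q)"
proof -
  have one: "a \<cdot>\<^sub>m 1\<^sub>m N \<in> carrier_mat N N" and bP: "b \<cdot>\<^sub>m P \<in> carrier_mat N N" using P by auto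
  have PQ: "P * Q \<in> carrier_mat N N" using P Q by (rule mult_carrier_mat)
  have "B * Q = a \<cdot>\<^sub>m Q + b \<cdot>\<^sub>m (P * Q)"
    unfolding B_def add_mult_distrib_mat[OF one bP Q] mult_smult_assoc_mat[OF P Q]
      mult_smult_assoc_mat[OF one_carrier_mat Q] using Q by simp
  moreover have X: "X * B = a \<cdot>\<^sub>m X + b \<cdot>\<^sub>m (X * P)" if X: "X \<in> carrier_mat N N" for X
    unfolding B_def mult_add_distrib_mat[OF X one bP] mult_smult_distrib[OF X P]
      mult_smult_distrib[OF X one_carrier_mat] using X by simp
  ultimately have "B * Q * B = a \<cdot>\<^sub>m (a \<cdot>\<^sub>m Q + b \<cdot>\<^sub>m (P * Q)) + b \<cdot>\<^sub>m ((a \<cdot>\<^sub>m Q + b \<cdot>\<^sub>m (P * Q)) * P)"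
    using Q PQ by simp
  also have "(a \<cdot>\<^sub>m Q + b \<cdot>\<^sub>m (P * Q)) * P = a \<cdot>\<^sub>m (e \<cdot>\<^sub>m (P * Q)) + b \<cdot>\<^sub>m (e \<cdot>\<^sub>m Q)"
  proof -
    have "P * Q * P = P * (e \<cdot>\<^sub>m (P * Q))" using assoc_mult_mat[OF P Q P] QP by simp
    also have "\<dots> = e \<cdot>\<^sub>m (P * P * Q)"
      using mult_smult_distrib[OF P PQ] assoc_mult_mat[OF P P Q] by simp
    finally have "P * Q * P = e \<cdot>\<^sub>m Q" using Q by (simp add: PP)
    thus ?thesis
      using add_mult_distrib_mat[OF smult_carrier_mat[OF Q] smult_carrier_mat[OF PQ] P]
        mult_smult_assoc_mat[OF Q P] mult_smult_assoc_mat[OF PQ P] QP by simp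
  qed
  finally show ?thesis
    using P Q PQ by (auto intro!: eq_matI simp: algebra_simps simp del: index_mult_mat(1))
qed

section \<open>Signed generators and their half-step exponentials\<close>

lemma gen_mat_involution:
  assumes "s t = 1 \<or> s t = -1" and p: "G t \<in> paulis n"
  shows "gen_mat n s G t * gen_mat n s G t = 1\<^sub>m (2^n)"
proof -
  have "gen_mat n s G t * gen_mat n s G t = complex_of_real (s t) \<cdot>\<^sub>m (complex_of_real (s t) \<cdot>\<^sub>m 1\<^sub>m (2^n))"
    unfolding gen_mat_def
    by (subst mult_smult_assoc_mat[OF pmat_carrier smult_carrier_mat[OF pmat_carrier]],
        subst mult_smult_distrib[OF pmat_carrier pmat_carrier]) (simp add: pmat_square[OF p])
  thus ?thesis using assms(1) by (auto intro!: eq_matI)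
qed

lemma gen_mat_carrier [simp]: "gen_mat n s G t \<in> carrier_mat (2^n) (2^n)"
  by (simp add: gen_mat_def)

lemma gen_mat_dim [simp]: "dim_row (gen_mat n s G t) = 2^n" "dim_col (gen_mat n s G t) = 2^n"
  by (simp_all add: gen_mat_def)

lemma gen_mat_adjoint: "mat_adjoint (gen_mat n s G t) = gen_mat n s G t"
proof (rule eq_matI)
  fix i j assume "i < dim_row (gen_mat n s G t)" "j < dim_col (gen_mat n s G t)"
  hence ij: "i < 2^n" "j < 2^n" by auto
  have "cnj (pmat n (G t) $$ (j,i)) = pmat n (G t) $$ (i,j)"
    using mat_adjoint_index[OF pmat_carrier ij, of "G t"] by (simp add: pmat_adjoint)
  thus "mat_adjoint (gen_mat n s G t) $$ (i,j) = gen_mat n s G t $$ (i,j)"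
    using ij by (simp add: mat_adjoint_index[OF gen_mat_carrier]) (simp add: gen_mat_def)
qed (auto simp: mat_adjoint_eq)

text \<open>The closed form of exp (-tau P_t / 2); \<open>chan_eq_half_step\<close> makes the
  connection.\<close>

definition half_step :: "nat \<Rightarrow> real \<Rightarrow> (nat \<Rightarrow> real) \<Rightarrow> (nat \<Rightarrow> nat \<Rightarrow> nat) \<Rightarrow> nat \<Rightarrow> complex mat" where
  "half_step n \<tau> s G t = complex_of_real (cosh (\<tau>/2)) \<cdot>\<^sub>m 1\<^sub>m (2^n)
     + complex_of_real (- sinh (\<tau>/2)) \<cdot>\<^sub>m gen_mat n s G t"

lemma half_step_carrier [simp]: "half_step n \<tau> s G t \<in> carrier_mat (2^n) (2^n)"
  by (simp add: half_step_def)

lemma half_step_dim [simp]: "dim_row (half_step n \<tau> s G t) = 2^n" "dim_col (half_step n \<tau> s G t) = 2^n"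
  by (simp_all add: half_step_def)

lemma half_step_adjoint: "mat_adjoint (half_step n \<tau> s G t) = half_step n \<tau> s G t"
proof (rule eq_matI)
  fix i j assume "i < dim_row (half_step n \<tau> s G t)" "j < dim_col (half_step n \<tau> s G t)"
  hence ij: "i < 2^n" "j < 2^n" by auto
  have "cnj (gen_mat n s G t $$ (j,i)) = gen_mat n s G t $$ (i,j)"
    using mat_adjoint_index[OF gen_mat_carrier ij, of s G t] by (simp add: gen_mat_adjoint)
  thus "mat_adjoint (half_step n \<tau> s G t) $$ (i,j) = half_step n \<tau> s G t $$ (i,j)"
    using ij by (simp add: mat_adjoint_index[OF half_step_carrier]) (simp add: half_step_def)
qed (auto simp: mat_adjoint_eq)

lemma cosh_complex_of_real: "cosh (complex_of_real x) = complex_of_real (cosh x)"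
  and sinh_complex_of_real: "sinh (complex_of_real x) = complex_of_real (sinh x)"
  using exp_of_real[of x, where 'a = complex] exp_of_real[of "-x", where 'a = complex]
  by (simp_all add: cosh_def sinh_def scaleR_conv_of_real)

lemma chan_eq_half_step:
  assumes "s t = 1 \<or> s t = -1" and "G t \<in> paulis n"
  shows "chan n \<tau> s G t X = half_step n \<tau> s G t * X * half_step n \<tau> s G t"
proof -
  have "mexp (complex_of_real (- \<tau> / 2) \<cdot>\<^sub>m gen_mat n s G t) = half_step n \<tau> s G t"
    unfolding mexp_involution[OF gen_mat_carrier gen_mat_involution[of s t G n, OF assms]] half_step_def
      cosh_complex_of_real sinh_complex_of_real by simp
  thus ?thesis by (simp add: chan_def)
qed

text \<open>With \<open>e = 1\<close> the coefficients are double-argument formulas at tau / 2,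
  which is why the channel carries cosh tau and sinh tau.\<close>

lemma half_step_commute:
  assumes "s t = 1 \<or> s t = -1" and "G t \<in> paulis n" and Q: "Q \<in> carrier_mat (2^n) (2^n)"
    and comm: "commutes (gen_mat n s G t) Q"
  shows "half_step n \<tau> s G t * Q * half_step n \<tau> s G t
    = complex_of_real (cosh \<tau>) \<cdot>\<^sub>m Q + complex_of_real (- sinh \<tau>) \<cdot>\<^sub>m (gen_mat n s G t * Q)"
proof -
  have "Q * gen_mat n s G t = 1 \<cdot>\<^sub>m (gen_mat n s G t * Q)"
    using comm by (auto simp: commutes_def)
  from conjugate_by_involution_combination[OF gen_mat_carrier gen_mat_involution[of s t G n, OF assms(1,2)] Q this]
  have "half_step n \<tau> s G t * Q * half_step n \<tau> s G t
    = complex_of_real ((cosh (\<tau>/2))\<^sup>2 + (sinh (\<tau>/2))\<^sup>2) \<cdot>\<^sub>m Q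
      + complex_of_real (- (2 * sinh (\<tau>/2) * cosh (\<tau>/2))) \<cdot>\<^sub>m (gen_mat n s G t * Q)"
    unfolding half_step_def by (simp add: power2_eq_square ac_simps)
  also have "(cosh (\<tau>/2))\<^sup>2 + (sinh (\<tau>/2))\<^sup>2 = cosh \<tau>" using cosh_double[of "\<tau>/2"] by simp
  also have "2 * sinh (\<tau>/2) * cosh (\<tau>/2) = sinh \<tau>" using sinh_double[of "\<tau>/2"] by simp
  finally show ?thesis .
qed

text \<open>With \<open>e = -1\<close> the mixed term cancels and the remaining coefficient is
  cosh^2 - sinh^2 = 1.\<close>

lemma half_step_anticommute:
  assumes "s t = 1 \<or> s t = -1" and "G t \<in> paulis n" and Q: "Q \<in> carrier_mat (2^n) (2^n)"
    and anti: "Q * gen_mat n s G t = (-1) \<cdot>\<^sub>m (gen_mat n s G t * Q)"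
  shows "half_step n \<tau> s G t * Q * half_step n \<tau> s G t = Q"
proof -
  from conjugate_by_involution_combination[OF gen_mat_carrier gen_mat_involution[of s t G n, OF assms(1,2)] Q anti]
  have "half_step n \<tau> s G t * Q * half_step n \<tau> s G t
    = complex_of_real ((cosh (\<tau>/2))\<^sup>2 - (sinh (\<tau>/2))\<^sup>2) \<cdot>\<^sub>m Q + 0 \<cdot>\<^sub>m (gen_mat n s G t * Q)"
    unfolding half_step_def by (simp add: power2_eq_square ac_simps)
  also have "(cosh (\<tau>/2))\<^sup>2 - (sinh (\<tau>/2))\<^sup>2 = 1" by (rule hyperbolic_pythagoras)
  also have "complex_of_real 1 \<cdot>\<^sub>m Q + 0 \<cdot>\<^sub>m (gen_mat n s G t * Q) = Q"
    using Q by (auto intro!: eq_matI simp del: index_mult_mat(1))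
  finally show ?thesis .
qed

text \<open>With \<open>R\<close> a Pauli string anticommuting with the generator, \<open>B R B = R\<close>.\<close>
lemma det_half_step_square:
  assumes s: "s t = 1 \<or> s t = -1" and G: "G t \<in> paulis n" "G t \<noteq> pauli_id"
  shows "det (half_step n \<tau> s G t) * det (half_step n \<tau> s G t) = 1"
proof -
  let ?B = "half_step n \<tau> s G t"
  obtain r where r: "r \<in> paulis n" "pmat n r * pmat n (G t) = (-1) \<cdot>\<^sub>m (pmat n (G t) * pmat n r)"
    using exists_anticommuting_string[OF G] .
  have "pmat n r * gen_mat n s G t = (-1) \<cdot>\<^sub>m (gen_mat n s G t * pmat n r)"
    unfolding gen_mat_def mult_smult_distrib[OF pmat_carrier pmat_carrier]
      mult_smult_assoc_mat[OF pmat_carrier pmat_carrier] r(2)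
    by (auto intro!: eq_matI)
  from half_step_anticommute[of s t G n, OF s G(1) pmat_carrier this]
  have "det (?B * pmat n r * ?B) = det (pmat n r)" by simp
  hence "det ?B * det (pmat n r) * det ?B = det (pmat n r)"
    by (simp add: det_mult[OF mult_carrier_mat[OF half_step_carrier pmat_carrier] half_step_carrier]
        det_mult[OF half_step_carrier pmat_carrier])
  moreover have "det (pmat n r) * det (pmat n r) = 1"
    using det_mult[OF pmat_carrier pmat_carrier, of n r r] by (simp add: pmat_square[OF r(1)])
  hence "det (pmat n r) \<noteq> 0" by auto
  ultimately show ?thesis by simp
qed

text \<open>Each channel is conjugation by a self-adjoint \<open>B\<close>, so the Gram factor
  \<open>V\<close> becomes B V, and the determinant is multiplied by det B^2 = 1.\<close>

lemma Aop_gram: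
  assumes s: "\<forall>t\<in>{1..L}. s t = 1 \<or> s t = -1" and G: "\<forall>t\<in>{1..L}. G t \<in> paulis n \<and> G t \<noteq> pauli_id"
  shows "\<exists>V\<in>carrier_mat (2^n) (2^n). Aop n \<tau> s G L = V * mat_adjoint V \<and> det (V * mat_adjoint V) = 1"
  using assms
proof (induction L)
  case 0
  show ?case by (intro bexI[of _ "1\<^sub>m (2^n)"]) auto
next
  case (Suc L)
  then obtain V where V: "V \<in> carrier_mat (2^n) (2^n)" and A: "Aop n \<tau> s G L = V * mat_adjoint V"
    and d: "det (V * mat_adjoint V) = 1" by auto
  let ?B = "half_step n \<tau> s G (Suc L)"
  have sG: "s (Suc L) = 1 \<or> s (Suc L) = -1" "G (Suc L) \<in> paulis n" "G (Suc L) \<noteq> pauli_id"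
    using Suc.prems by auto
  have V': "mat_adjoint V \<in> carrier_mat (2^n) (2^n)" using V by simp
  have B: "?B \<in> carrier_mat (2^n) (2^n)" by simp
  have BV: "?B * V \<in> carrier_mat (2^n) (2^n)" by (rule mult_carrier_mat[OF B V])
  have VV: "V * mat_adjoint V \<in> carrier_mat (2^n) (2^n)" by (rule mult_carrier_mat[OF V V'])
  have "Aop n \<tau> s G (Suc L) = ?B * (V * mat_adjoint V) * ?B"
    by (simp add: A chan_eq_half_step[of s "Suc L" G n, OF sG(1,2)])
  also have "\<dots> = (?B * V) * mat_adjoint (?B * V)"
    unfolding mat_adjoint_mult[OF B V] half_step_adjoint
    using assoc_mult_mat[OF B V V'] assoc_mult_mat[OF BV V' B] by simp
  finally have eq: "Aop n \<tau> s G (Suc L) = (?B * V) * mat_adjoint (?B * V)" .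
  have "det (Aop n \<tau> s G (Suc L)) = det ?B * det (V * mat_adjoint V) * det ?B"
    by (simp add: A chan_eq_half_step[of s "Suc L" G n, OF sG(1,2)] det_mult[OF mult_carrier_mat[OF B VV] B] det_mult[OF B VV])
  hence "det (Aop n \<tau> s G (Suc L)) = 1"
    using d det_half_step_square[of s "Suc L" G n, OF sG] by simp
  thus ?case using BV eq by (intro bexI[of _ "?B * V"]) auto
qed

section \<open>Pauli paths\<close>

text \<open>The single-step condition inside \<open>pauli_path\<close>, isolated so that paths can
  be extended one string at a time.\<close>

definition valid_step :: "nat \<Rightarrow> complex mat \<Rightarrow> (nat \<Rightarrow> nat) \<Rightarrow> (nat \<Rightarrow> nat) \<Rightarrow> bool" where
  "valid_step n P q r \<longleftrightarrow> (let a = step_a n P q r; b = step_b n P q r; c = step_c n P q r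
     in (a \<and> \<not> b \<and> \<not> c) \<or> (\<not> a \<and> b \<and> \<not> c) \<or> (\<not> a \<and> \<not> b \<and> c))"

definition successors :: "nat \<Rightarrow> complex mat \<Rightarrow> (nat \<Rightarrow> nat) \<Rightarrow> (nat \<Rightarrow> nat) set" where
  "successors n P q = {r \<in> paulis n. valid_step n P q r}"

lemma pmat_smult_cancel:
  assumes r: "r \<in> paulis n" and eq: "a \<cdot>\<^sub>m pmat n r = b \<cdot>\<^sub>m pmat n r"
  shows "a = b"
proof -
  have "pmat n r * (a \<cdot>\<^sub>m pmat n r) = pmat n r * (b \<cdot>\<^sub>m pmat n r)" by (simp add: eq)
  hence "a \<cdot>\<^sub>m 1\<^sub>m (2^n) = (b \<cdot>\<^sub>m 1\<^sub>m (2^n) :: complex mat)"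
    by (simp only: mult_smult_distrib[OF pmat_carrier pmat_carrier] pmat_square[OF r])
  hence "(a \<cdot>\<^sub>m 1\<^sub>m (2^n)) $$ (0,0) = (b \<cdot>\<^sub>m 1\<^sub>m (2^n) :: complex mat) $$ (0,0)" by simp
  thus ?thesis by simp
qed

lemma smult_smult_mat: "a \<cdot>\<^sub>m (b \<cdot>\<^sub>m X) = (a * b) \<cdot>\<^sub>m (X :: complex mat)"
  by (rule eq_matI) auto

lemma uminus_smult_mat: "- (a \<cdot>\<^sub>m X) = (- a) \<cdot>\<^sub>m (X :: complex mat)"
  by (rule eq_matI) auto

text \<open>The phase of the product decides. If it is imaginary, only the step that keeps
  \<open>q\<close> is possible. If it is real, keeping \<open>q\<close> and moving to the product
  string \<open>r\<close> are both possible, and they never coincide because the generator is not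
  the identity.\<close>

lemma pauli_step_cases:
  assumes s: "s t = 1 \<or> s t = -1" and p: "G t \<in> paulis n" "G t \<noteq> pauli_id" and q: "q \<in> paulis n"
  defines "P \<equiv> gen_mat n s G t"
  obtains (anti) "anticommutes P (pmat n q)" "successors n P q = {q}"
      "step_factor n \<tau> P q q = 1" "\<not> step_c n P q q"
  | (comm) \<sigma> r where "commutes P (pmat n q)" "\<sigma> = 1 \<or> \<sigma> = -1" "r \<noteq> q"
      "P * pmat n q = complex_of_real \<sigma> \<cdot>\<^sub>m pmat n r" "successors n P q = {q, r}"
      "step_factor n \<tau> P q q = cosh \<tau>" "step_factor n \<tau> P q r = - \<sigma> * sinh \<tau>"
      "\<not> step_c n P q q" "step_c n P q r"
proof -
  define z where "z = string_phase n (G t) q"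
  define r where "r = string_dot (G t) q"
  have r: "r \<in> paulis n" unfolding r_def by (rule string_dot_paulis[OF p(1) q])
  have PQ: "P * pmat n q = (complex_of_real (s t) * z) \<cdot>\<^sub>m pmat n r"
    unfolding P_def gen_mat_def mult_smult_assoc_mat[OF pmat_carrier pmat_carrier]
      pmat_mult[OF p(1) q] smult_smult_mat r_def z_def ..
  have QP: "pmat n q * P = (complex_of_real (s t) * cnj z) \<cdot>\<^sub>m pmat n r"
    unfolding P_def gen_mat_def mult_smult_distrib[OF pmat_carrier pmat_carrier]
      pmat_mult[OF q p(1)] smult_smult_mat r_def z_def string_dot_commute[of q] string_phase_swap[OF p(1) q] ..
  \<comment> \<open>Equality would force every site of the generator to be the identity.\<close>
  have rq: "r \<noteq> q"
  proof
    assume "r = q"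
    hence "pauli_dot (G t i) (q i) = q i" for i by (metis r_def string_dot_def)
    hence "G t i = 0" for i using pauli_dot_eq_right[OF paulis_less[OF p(1)] paulis_less[OF q]] by blast
    thus False using p(2) by (auto simp: pauli_id_def)
  qed
  have comm_iff: "commutes P (pmat n q) \<longleftrightarrow> complex_of_real (s t) * z = complex_of_real (s t) * cnj z"
    unfolding commutes_def PQ QP using pmat_smult_cancel[OF r] by metis
  have anti_iff: "anticommutes P (pmat n q) \<longleftrightarrow> complex_of_real (s t) * z = - (complex_of_real (s t) * cnj z)"
    unfolding anticommutes_def PQ QP uminus_smult_mat using pmat_smult_cancel[OF r] by metis
  have "z \<in> {1,-1,\<i>,-\<i>}" unfolding z_def by (rule string_phase_cases)
  then consider (real) "z = 1 \<or> z = -1" | (imag) "z = \<i> \<or> z = -\<i>" by auto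
  thus thesis
  proof cases
    case imag
    have A: "anticommutes P (pmat n q)" and C: "\<not> commutes P (pmat n q)"
      unfolding comm_iff anti_iff using s imag by auto
    have "successors n P q = {q}"
      using A C q by (auto simp: successors_def valid_step_def step_a_def step_b_def step_c_def)
    thus ?thesis using A C by (intro anti) (auto simp: step_factor_def step_a_def step_c_def)
  next
    case real
    have A: "\<not> anticommutes P (pmat n q)" and C: "commutes P (pmat n q)"
      unfolding comm_iff anti_iff using s real by auto
    \<comment> \<open>The phase is real here, so it combines with the sign of the generator into one
      real sign.\<close>
    define \<sigma> where "\<sigma> = s t * Re z"
    have sg: "\<sigma> = 1 \<or> \<sigma> = -1" using s real by (auto simp: \<sigma>_def)
    have PQ': "P * pmat n q = complex_of_real \<sigma> \<cdot>\<^sub>m pmat n r"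
      unfolding PQ \<sigma>_def using real by auto
    have c: "step_c n P q x \<longleftrightarrow> x = r" if x: "x \<in> paulis n" for x
    proof
      assume "step_c n P q x"
      then obtain s' where "complex_of_real \<sigma> \<cdot>\<^sub>m pmat n r = complex_of_real s' \<cdot>\<^sub>m pmat n x"
        unfolding step_c_def PQ' by blast
      from pmat_eq_smult_imp_eq[OF r x this] sg show "x = r" by auto
    next
      assume "x = r"
      thus "step_c n P q x" unfolding step_c_def using C sg PQ' by blast
    qed
    have ab: "\<not> step_a n P q x" "step_b n P q x \<longleftrightarrow> x = q" for x
      using A C by (auto simp: step_a_def step_b_def)
    have succ: "successors n P q = {q, r}"
      using q r rq by (auto simp: successors_def valid_step_def ab c)
    have "step_sign n P q r = \<sigma>"
      unfolding step_sign_def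
    proof (rule the_equality)
      fix s' :: real assume "(s' = 1 \<or> s' = -1) \<and> P * pmat n q = complex_of_real s' \<cdot>\<^sub>m pmat n r"
      hence "complex_of_real s' \<cdot>\<^sub>m pmat n r = complex_of_real \<sigma> \<cdot>\<^sub>m pmat n r" using PQ' by simp
      from pmat_smult_cancel[OF r this] show "s' = \<sigma>" by simp
    qed (use sg PQ' in simp)
    thus ?thesis using C sg rq PQ' succ
      by (intro comm[of \<sigma> r]) (auto simp: step_factor_def ab c q r)
  qed
qed

text \<open>The one-step path expansion: both cases of \<open>pauli_step_cases\<close> reproduce the
  action of the channel on a Pauli string.\<close>

lemma sum_successors_half_step:
  assumes s: "s t = 1 \<or> s t = -1" and p: "G t \<in> paulis n" "G t \<noteq> pauli_id" and q: "q \<in> paulis n"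
    and ij: "i < 2^n" "j < 2^n"
  shows "(half_step n \<tau> s G t * pmat n q * half_step n \<tau> s G t) $$ (i,j)
    = (\<Sum>r\<in>successors n (gen_mat n s G t) q.
        complex_of_real (step_factor n \<tau> (gen_mat n s G t) q r) * pmat n r $$ (i,j))"
proof (cases rule: pauli_step_cases[of s t G n q \<tau>, OF s p q, case_names anti comm])
  case anti
  have "pmat n q * gen_mat n s G t = (-1) \<cdot>\<^sub>m (gen_mat n s G t * pmat n q)"
    using anti(1) unfolding anticommutes_def by (auto intro!: eq_matI simp del: index_mult_mat(1))
  from half_step_anticommute[of s t G n, OF s p(1) pmat_carrier this] anti show ?thesis by simp
next
  case (comm \<sigma> r)
  show ?thesis
    unfolding half_step_commute[of s t G n, OF s p(1) pmat_carrier comm(1)] comm(4)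
    using comm ij by (simp add: algebra_simps)
qed

text \<open>In the commuting case the two successors give equality; in the anticommuting case the
  sum is 1, which is at most cosh tau.\<close>

lemma sum_successors_weight_le:
  assumes s: "s t = 1 \<or> s t = -1" and p: "G t \<in> paulis n" "G t \<noteq> pauli_id" and q: "q \<in> paulis n"
    and "\<tau> \<ge> 0" "w \<ge> 0"
  shows "(\<Sum>r\<in>successors n (gen_mat n s G t) q. \<bar>step_factor n \<tau> (gen_mat n s G t) q r\<bar>
      * w ^ of_bool (step_c n (gen_mat n s G t) q r)) \<le> cosh \<tau> + w * sinh \<tau>"
proof (cases rule: pauli_step_cases[of s t G n q \<tau>, OF s p q, case_names anti comm])
  case anti
  have "0 \<le> w * sinh \<tau>" using assms by simp
  moreover have "1 \<le> cosh \<tau>" by (rule cosh_real_ge_1)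
  ultimately show ?thesis using anti by simp
next
  case (comm \<sigma> r)
  have "\<bar>\<sigma>\<bar> = 1" using comm(2) by auto
  thus ?thesis using comm assms(5) by (simp add: abs_mult)
qed

section \<open>Finiteness of the path set and recursion on the path length\<close>

lemma finite_paulis: "finite (paulis n)"
proof -
  have "paulis n = {f. \<forall>x. (x \<in> {..<n} \<longrightarrow> f x \<in> {..<4}) \<and> (x \<notin> {..<n} \<longrightarrow> f x = 0)}"
    by (auto simp: paulis_def)
  thus ?thesis using finite_set_of_finite_funs[of "{..<n}" "{..<4::nat}" 0] by simp
qed

lemma finite_paths: "finite {\<gamma>. pauli_path n s G L \<gamma>}"
  by (rule finite_subset[OF _ finite_lists_length_eq[OF finite_paulis, of n "L + 1"]])
    (auto simp: pauli_path_def)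

lemma pauli_path_length: "pauli_path n s G L \<gamma> \<Longrightarrow> length \<gamma> = Suc L"
  by (simp add: pauli_path_def)

lemma pauli_path_nth: "pauli_path n s G L \<gamma> \<Longrightarrow> t \<le> L \<Longrightarrow> \<gamma> ! t \<in> paulis n"
  by (auto simp: pauli_path_def subset_eq)

lemma paths_0: "{\<gamma>. pauli_path n s G 0 \<gamma>} = {[pauli_id]}"
  by (auto simp: pauli_path_def length_Suc_conv paulis_def pauli_id_def)

lemma pauli_path_snoc:
  assumes len: "length \<gamma> = Suc L"
  shows "pauli_path n s G (Suc L) (\<gamma> @ [r]) \<longleftrightarrow>
    pauli_path n s G L \<gamma> \<and> r \<in> successors n (gen_mat n s G (Suc L)) (\<gamma> ! L)"
proof -
  have path: "pauli_path n s G M \<delta> \<longleftrightarrow> length \<delta> = M + 1 \<and> set \<delta> \<subseteq> paulis n \<and> \<delta> ! 0 = pauli_id \<and>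
     (\<forall>t\<in>{1..M}. valid_step n (gen_mat n s G t) (\<delta> ! (t - 1)) (\<delta> ! t))" for M \<delta>
    by (simp add: pauli_path_def valid_step_def Let_def)
  have "(\<forall>t\<in>{1..Suc L}. valid_step n (gen_mat n s G t) ((\<gamma> @ [r]) ! (t - 1)) ((\<gamma> @ [r]) ! t))
    \<longleftrightarrow> (\<forall>t\<in>{1..L}. valid_step n (gen_mat n s G t) (\<gamma> ! (t - 1)) (\<gamma> ! t))
      \<and> valid_step n (gen_mat n s G (Suc L)) (\<gamma> ! L) r"
    using len by (auto simp: atLeastAtMostSuc_conv nth_append)
  thus ?thesis unfolding path using len by (auto simp: successors_def nth_append)
qed

text \<open>Splitting off the last string is a bijection onto pairs of a shorter path and an
  admissible successor. Both inductions over paths rest on this.\<close>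

lemma sum_paths_Suc:
  fixes f :: "(nat \<Rightarrow> nat) list \<Rightarrow> 'a :: comm_monoid_add"
  shows "(\<Sum>\<gamma> | pauli_path n s G (Suc L) \<gamma>. f \<gamma>)
    = (\<Sum>\<gamma> | pauli_path n s G L \<gamma>. \<Sum>r\<in>successors n (gen_mat n s G (Suc L)) (\<gamma> ! L). f (\<gamma> @ [r]))"
proof -
  let ?S = "SIGMA \<gamma>:{\<gamma>. pauli_path n s G L \<gamma>}. successors n (gen_mat n s G (Suc L)) (\<gamma> ! L)"
  have "{\<gamma>. pauli_path n s G (Suc L) \<gamma>} = (\<lambda>(\<gamma>, r). \<gamma> @ [r]) ` ?S"
  proof (intro equalityI subsetI)
    fix \<delta> assume "\<delta> \<in> {\<gamma>. pauli_path n s G (Suc L) \<gamma>}"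
    hence d: "pauli_path n s G (Suc L) \<delta>" by simp
    hence "\<delta> = butlast \<delta> @ [last \<delta>]" "length (butlast \<delta>) = Suc L"
      using pauli_path_length[OF d] by (auto simp: append_butlast_last_id simp flip: length_greater_0_conv)
    thus "\<delta> \<in> (\<lambda>(\<gamma>, r). \<gamma> @ [r]) ` ?S"
      using d pauli_path_snoc[of "butlast \<delta>" L n s G "last \<delta>"]
      by (intro image_eqI[of _ _ "(butlast \<delta>, last \<delta>)"]) auto
  next
    fix \<delta> assume "\<delta> \<in> (\<lambda>(\<gamma>, r). \<gamma> @ [r]) ` ?S"
    thus "\<delta> \<in> {\<gamma>. pauli_path n s G (Suc L) \<gamma>}"
      using pauli_path_snoc pauli_path_length by fastforce
  qed
  hence "(\<Sum>\<gamma> | pauli_path n s G (Suc L) \<gamma>. f \<gamma>) = sum f ((\<lambda>(\<gamma>, r). \<gamma> @ [r]) ` ?S)" by simp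
  also have "\<dots> = (\<Sum>(\<gamma>, r)\<in>?S. f (\<gamma> @ [r]))"
    by (subst sum.reindex) (auto simp: inj_on_def case_prod_unfold)
  also have "\<dots> = (\<Sum>\<gamma> | pauli_path n s G L \<gamma>. \<Sum>r\<in>successors n (gen_mat n s G (Suc L)) (\<gamma> ! L). f (\<gamma> @ [r]))"
    by (rule sum.Sigma[symmetric]) (auto simp: finite_paths successors_def finite_paulis)
  finally show ?thesis .
qed

lemma path_coef_snoc:
  assumes "length \<gamma> = Suc L"
  shows "path_coef n \<tau> s G (Suc L) (\<gamma> @ [r])
    = path_coef n \<tau> s G L \<gamma> * step_factor n \<tau> (gen_mat n s G (Suc L)) (\<gamma> ! L) r"
proof -
  have "(\<Prod>t\<in>{1..L}. step_factor n \<tau> (gen_mat n s G t) ((\<gamma> @ [r]) ! (t - 1)) ((\<gamma> @ [r]) ! t))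
    = path_coef n \<tau> s G L \<gamma>"
    unfolding path_coef_def using assms by (intro prod.cong refl) (auto simp: nth_append)
  thus ?thesis using assms by (simp add: path_coef_def nth_append)
qed

lemma path_r_snoc:
  assumes "length \<gamma> = Suc L"
  shows "path_r n s G (Suc L) (\<gamma> @ [r])
    = path_r n s G L \<gamma> + of_bool (step_c n (gen_mat n s G (Suc L)) (\<gamma> ! L) r)"
proof -
  let ?c = "step_c n (gen_mat n s G (Suc L)) (\<gamma> ! L) r"
  let ?T = "{t\<in>{1..L}. step_c n (gen_mat n s G t) (\<gamma> ! (t - 1)) (\<gamma> ! t)}"
  have eq: "{t\<in>{1..Suc L}. step_c n (gen_mat n s G t) ((\<gamma> @ [r]) ! (t - 1)) ((\<gamma> @ [r]) ! t)}
    = ?T \<union> (if ?c then {Suc L} else {})"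
    using assms by (auto simp: nth_append le_Suc_eq)
  show ?thesis unfolding path_r_def eq by (subst card_Un_disjoint) auto
qed

lemma Aop_carrier: "Aop n \<tau> s G L \<in> carrier_mat (2^n) (2^n)"
proof (induction L)
  case (Suc L)
  have "mexp (complex_of_real (- \<tau> / 2) \<cdot>\<^sub>m gen_mat n s G (Suc L)) \<in> carrier_mat (2^n) (2^n)"
    by (simp add: mexp_def)
  thus ?case by (simp add: chan_def mult_carrier_mat[OF mult_carrier_mat[OF _ Suc]])
qed simp

text \<open>Exhibits the entries of B X B as linear in those of \<open>X\<close>, so that the
  channel passes through a sum over paths.\<close>

lemma triple_product_index:
  assumes B: "(B :: complex mat) \<in> carrier_mat N N" and X: "X \<in> carrier_mat N N" and ij: "i < N" "j < N"
  shows "(B * X * B) $$ (i,j) = (\<Sum>a<N. \<Sum>b<N. X $$ (b,a) * (B $$ (i,b) * B $$ (a,j)))"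
  unfolding mult_mat_index[OF mult_carrier_mat[OF B X] B ij]
  by (intro sum.cong refl)
    (simp add: mult_mat_index[OF B X ij(1)] sum_distrib_right mult.assoc mult.left_commute del: index_mult_mat)

lemma sum_swap3:
  "(\<Sum>a\<in>A. \<Sum>b\<in>B. \<Sum>g\<in>C. f a b g) = (\<Sum>g\<in>C. \<Sum>a\<in>A. \<Sum>b\<in>B. f a b g :: 'a :: comm_monoid_add)"
proof -
  have "(\<Sum>a\<in>A. \<Sum>b\<in>B. \<Sum>g\<in>C. f a b g) = (\<Sum>a\<in>A. \<Sum>g\<in>C. \<Sum>b\<in>B. f a b g)"
    by (intro sum.cong refl sum.swap)
  also have "\<dots> = (\<Sum>g\<in>C. \<Sum>a\<in>A. \<Sum>b\<in>B. f a b g)" by (rule sum.swap)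
  finally show ?thesis .
qed

text \<open>The Pauli-path expansion, stated entrywise like \<open>Atrunc\<close>. The channel acts
  linearly on the expansion at time \<open>L\<close>, and each string branches into its
  successors.\<close>

lemma Aop_path_expansion:
  assumes s: "\<forall>t\<in>{1..L}. s t = 1 \<or> s t = -1" and G: "\<forall>t\<in>{1..L}. G t \<in> paulis n \<and> G t \<noteq> pauli_id"
    and ij: "i < 2^n" "j < 2^n"
  shows "Aop n \<tau> s G L $$ (i,j)
    = (\<Sum>\<gamma> | pauli_path n s G L \<gamma>. complex_of_real (path_coef n \<tau> s G L \<gamma>) * pmat n (\<gamma> ! L) $$ (i,j))"
  using assms
proof (induction L arbitrary: i j)
  case 0
  thus ?case by (simp add: paths_0 path_coef_def pmat_id)
next
  case (Suc L)
  let ?B = "half_step n \<tau> s G (Suc L)" and ?A = "Aop n \<tau> s G L"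
  let ?S = "{\<gamma>. pauli_path n s G L \<gamma>}" and ?P = "gen_mat n s G (Suc L)"
  let ?c = "\<lambda>\<gamma>. complex_of_real (path_coef n \<tau> s G L \<gamma>)"
  have sG: "s (Suc L) = 1 \<or> s (Suc L) = -1" "G (Suc L) \<in> paulis n" "G (Suc L) \<noteq> pauli_id"
    using Suc.prems by auto
  have IH: "?A $$ (a,b) = (\<Sum>\<gamma>\<in>?S. ?c \<gamma> * pmat n (\<gamma> ! L) $$ (a,b))" if "a < 2^n" "b < 2^n" for a b
    using Suc.IH[of a b] Suc.prems that by auto
  have "Aop n \<tau> s G (Suc L) $$ (i,j) = (?B * ?A * ?B) $$ (i,j)"
    by (simp add: chan_eq_half_step[of s "Suc L" G n, OF sG(1,2)])
  also have "\<dots> = (\<Sum>a<2^n. \<Sum>b<2^n. \<Sum>\<gamma>\<in>?S. ?c \<gamma> * (pmat n (\<gamma> ! L) $$ (b,a) * (?B $$ (i,b) * ?B $$ (a,j))))"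
    unfolding triple_product_index[OF half_step_carrier Aop_carrier Suc.prems(3,4)]
    by (intro sum.cong refl) (simp add: IH sum_distrib_right mult.assoc)
  also have "\<dots> = (\<Sum>\<gamma>\<in>?S. ?c \<gamma> * (?B * pmat n (\<gamma> ! L) * ?B) $$ (i,j))"
    unfolding triple_product_index[OF half_step_carrier pmat_carrier Suc.prems(3,4)] sum_distrib_left
    by (rule sum_swap3)
  also have "\<dots> = (\<Sum>\<gamma>\<in>?S. \<Sum>r\<in>successors n ?P (\<gamma> ! L).
      complex_of_real (path_coef n \<tau> s G (Suc L) (\<gamma> @ [r])) * pmat n ((\<gamma> @ [r]) ! Suc L) $$ (i,j))"
  proof (rule sum.cong[OF refl])
    fix \<gamma> assume "\<gamma> \<in> ?S"
    hence g: "pauli_path n s G L \<gamma>" by simp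
    show "?c \<gamma> * (?B * pmat n (\<gamma> ! L) * ?B) $$ (i,j) = (\<Sum>r\<in>successors n ?P (\<gamma> ! L).
      complex_of_real (path_coef n \<tau> s G (Suc L) (\<gamma> @ [r])) * pmat n ((\<gamma> @ [r]) ! Suc L) $$ (i,j))"
      unfolding sum_successors_half_step[of s "Suc L" G n, OF sG pauli_path_nth[OF g order_refl] Suc.prems(3,4)]
        path_coef_snoc[OF pauli_path_length[OF g]] sum_distrib_left
      using pauli_path_length[OF g] by (simp add: nth_append mult.assoc)
  qed
  also have "\<dots> = (\<Sum>\<gamma> | pauli_path n s G (Suc L) \<gamma>.
      complex_of_real (path_coef n \<tau> s G (Suc L) \<gamma>) * pmat n (\<gamma> ! Suc L) $$ (i,j))"
    by (rule sum_paths_Suc[symmetric])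
  finally show ?case .
qed

text \<open>A generating function in \<open>w\<close> for the number of updates: every step
  multiplies it by at most \<open>cosh \<tau> + w * sinh \<tau>\<close>.\<close>

lemma path_weight_sum_le:
  assumes s: "\<forall>t\<in>{1..L}. s t = 1 \<or> s t = -1" and G: "\<forall>t\<in>{1..L}. G t \<in> paulis n \<and> G t \<noteq> pauli_id"
    and \<tau>: "\<tau> \<ge> 0" and w: "w \<ge> 0"
  shows "(\<Sum>\<gamma> | pauli_path n s G L \<gamma>. \<bar>path_coef n \<tau> s G L \<gamma>\<bar> * w ^ path_r n s G L \<gamma>)
    \<le> (cosh \<tau> + w * sinh \<tau>) ^ L"
  using s G
proof (induction L)
  case 0
  thus ?case by (simp add: paths_0 path_coef_def path_r_def)
next
  case (Suc L)
  let ?P = "gen_mat n s G (Suc L)" and ?S = "{\<gamma>. pauli_path n s G L \<gamma>}"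
  have sG: "s (Suc L) = 1 \<or> s (Suc L) = -1" "G (Suc L) \<in> paulis n" "G (Suc L) \<noteq> pauli_id"
    using Suc.prems by auto
  have "(\<Sum>\<gamma> | pauli_path n s G (Suc L) \<gamma>. \<bar>path_coef n \<tau> s G (Suc L) \<gamma>\<bar> * w ^ path_r n s G (Suc L) \<gamma>)
    = (\<Sum>\<gamma>\<in>?S. (\<bar>path_coef n \<tau> s G L \<gamma>\<bar> * w ^ path_r n s G L \<gamma>)
        * (\<Sum>r\<in>successors n ?P (\<gamma> ! L). \<bar>step_factor n \<tau> ?P (\<gamma> ! L) r\<bar> * w ^ of_bool (step_c n ?P (\<gamma> ! L) r)))"
    unfolding sum_paths_Suc
    by (rule sum.cong[OF refl])
      (simp add: path_coef_snoc path_r_snoc pauli_path_length abs_mult power_add sum_distrib_left ac_simps)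
  also have "\<dots> \<le> (\<Sum>\<gamma>\<in>?S. (\<bar>path_coef n \<tau> s G L \<gamma>\<bar> * w ^ path_r n s G L \<gamma>) * (cosh \<tau> + w * sinh \<tau>))"
    using w by (intro sum_mono mult_left_mono sum_successors_weight_le[of s "Suc L" G n, OF sG _ \<tau> w])
      (auto intro: pauli_path_nth)
  also have "\<dots> = (\<Sum>\<gamma>\<in>?S. \<bar>path_coef n \<tau> s G L \<gamma>\<bar> * w ^ path_r n s G L \<gamma>) * (cosh \<tau> + w * sinh \<tau>)"
    by (simp add: sum_distrib_right)
  also have "\<dots> \<le> (cosh \<tau> + w * sinh \<tau>) ^ L * (cosh \<tau> + w * sinh \<tau>)"
    using Suc \<tau> w by (intro mult_right_mono add_nonneg_nonneg mult_nonneg_nonneg) auto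
  finally show ?case by (simp add: mult.commute)
qed

text \<open>After factoring out exp tau, use (1 - exp (-2 tau)) / 2 <= tau and then 1 + y <= exp y.
  The assumption on \<open>w\<close> keeps the multiplier w - 1 nonnegative.\<close>

lemma cosh_plus_sinh_le_exp:
  fixes \<tau> w :: real
  assumes "w \<ge> 1"
  shows "cosh \<tau> + w * sinh \<tau> \<le> exp (w * \<tau>)"
proof -
  have 1: "1 - exp (- 2 * \<tau>) \<le> 2 * \<tau>" using exp_ge_add_one_self[of "- 2 * \<tau>"] by simp
  have "cosh \<tau> + w * sinh \<tau> = exp \<tau> * (1 + (w - 1) * ((1 - exp (- 2 * \<tau>)) / 2))"
    by (simp add: cosh_def sinh_def field_simps flip: exp_add)
  also have "\<dots> \<le> exp \<tau> * (1 + (w - 1) * \<tau>)"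
    using assms 1 by (intro mult_left_mono add_left_mono) auto
  also have "\<dots> \<le> exp \<tau> * exp ((w - 1) * \<tau>)" by (intro mult_left_mono exp_ge_add_one_self) auto
  finally show ?thesis by (simp add: algebra_simps flip: exp_add)
qed

text \<open>Chernoff bound with weight \<open>w = k / (L \<tau>)\<close>.\<close>
lemma path_tail_le:
  assumes s: "\<forall>t\<in>{1..L}. s t = 1 \<or> s t = -1" and G: "\<forall>t\<in>{1..L}. G t \<in> paulis n \<and> G t \<noteq> pauli_id"
    and \<tau>: "\<tau> > 0" and L: "L \<ge> 1" and k: "real k \<ge> real L * \<tau>"
  shows "(\<Sum>\<gamma> | pauli_path n s G L \<gamma> \<and> path_r n s G L \<gamma> > k. \<bar>path_coef n \<tau> s G L \<gamma>\<bar>)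
    \<le> (exp 1 * (real L * \<tau>) / real k) ^ k"
proof -
  define x where "x = real L * \<tau>"
  define w where "w = real k / x"
  have x: "x > 0" using L \<tau> by (simp add: x_def)
  have w: "w \<ge> 1" using k x by (simp add: w_def x_def)
  \<comment> \<open>Discarded paths have more than \<open>k\<close> updates, so w >= 1 gives w^k <=
    w^r.\<close>
  have "(\<Sum>\<gamma> | pauli_path n s G L \<gamma> \<and> path_r n s G L \<gamma> > k. \<bar>path_coef n \<tau> s G L \<gamma>\<bar>) * w ^ k
    \<le> (\<Sum>\<gamma> | pauli_path n s G L \<gamma> \<and> path_r n s G L \<gamma> > k. \<bar>path_coef n \<tau> s G L \<gamma>\<bar> * w ^ path_r n s G L \<gamma>)"
    unfolding sum_distrib_right using w by (intro sum_mono mult_left_mono power_increasing) auto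
  also have "\<dots> \<le> (\<Sum>\<gamma> | pauli_path n s G L \<gamma>. \<bar>path_coef n \<tau> s G L \<gamma>\<bar> * w ^ path_r n s G L \<gamma>)"
    using w by (intro sum_mono2 finite_paths) auto
  also have "\<dots> \<le> (cosh \<tau> + w * sinh \<tau>) ^ L"
    using \<tau> w by (intro path_weight_sum_le[OF s G]) auto
  also have "\<dots> \<le> exp (w * \<tau>) ^ L"
    using \<tau> w by (intro power_mono cosh_plus_sinh_le_exp add_nonneg_nonneg mult_nonneg_nonneg) auto
  also have "\<dots> = exp (w * x)" by (simp add: x_def ac_simps flip: exp_of_nat_mult)
  \<comment> \<open>The choice of \<open>w\<close> turns the exponent into \<open>k\<close>;
    dividing by w^k leaves (e x / k)^k.\<close>
  also have "w * x = real k * 1" using x by (simp add: w_def)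
  also have "exp (real k * 1) = exp 1 ^ k" by (rule exp_of_nat_mult)
  finally have "(\<Sum>\<gamma> | pauli_path n s G L \<gamma> \<and> path_r n s G L \<gamma> > k. \<bar>path_coef n \<tau> s G L \<gamma>\<bar>) \<le> exp 1 ^ k / w ^ k"
    using w by (simp add: pos_le_divide_eq)
  also have "\<dots> = (exp 1 * x / real k) ^ k" by (simp add: w_def power_divide[symmetric])
  finally show ?thesis by (simp add: x_def)
qed

section \<open>Truncation error\<close>

lemma Atrunc_carrier: "Atrunc n \<tau> s G L k \<in> carrier_mat (2^n) (2^n)"
  by (simp add: Atrunc_def)

text \<open>The difference expands over the discarded paths, and each string contributes at most c
  2^n because its 2^n columns are unit vectors.\<close>

lemma mtrace_truncation_error_le:
  assumes s: "\<forall>t\<in>{1..L}. s t = 1 \<or> s t = -1" and G: "\<forall>t\<in>{1..L}. G t \<in> paulis n \<and> G t \<noteq> pauli_id"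
    and M: "M \<in> carrier_mat (2^n) (2^n)"
    and c: "\<And>v. v \<in> carrier_vec (2^n) \<Longrightarrow> vnorm (M *\<^sub>v v) \<le> c * vnorm v"
  shows "cmod (mtrace (M * (Aop n \<tau> s G L - Atrunc n \<tau> s G L k)))
    \<le> c * 2^n * (\<Sum>\<gamma> | pauli_path n s G L \<gamma> \<and> path_r n s G L \<gamma> > k. \<bar>path_coef n \<tau> s G L \<gamma>\<bar>)"
proof -
  let ?T = "{\<gamma>. pauli_path n s G L \<gamma> \<and> path_r n s G L \<gamma> > k}"
  let ?D = "Aop n \<tau> s G L - Atrunc n \<tau> s G L k"
  let ?c = "\<lambda>\<gamma>. complex_of_real (path_coef n \<tau> s G L \<gamma>)"
  have D: "?D \<in> carrier_mat (2^n) (2^n)" by (rule minus_carrier_mat[OF Atrunc_carrier])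
  have entry: "?D $$ (i,j) = (\<Sum>\<gamma>\<in>?T. ?c \<gamma> * pmat n (\<gamma> ! L) $$ (i,j))" if ij: "i < 2^n" "j < 2^n" for i j
  proof -
    let ?f = "\<lambda>\<gamma>. ?c \<gamma> * pmat n (\<gamma> ! L) $$ (i,j)"
    let ?K = "{\<gamma>. pauli_path n s G L \<gamma> \<and> path_r n s G L \<gamma> \<le> k}"
    have "?D $$ (i,j) = (\<Sum>\<gamma> | pauli_path n s G L \<gamma>. ?f \<gamma>) - sum ?f ?K"
      using ij Aop_path_expansion[OF s G ij] carrier_matD[OF Atrunc_carrier[of n \<tau> s G L k]]
      by (simp add: Atrunc_def)
    also have "{\<gamma>. pauli_path n s G L \<gamma>} = ?K \<union> ?T" by auto
    also have "sum ?f (?K \<union> ?T) = sum ?f ?K + sum ?f ?T"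
      by (rule sum.union_disjoint) (auto intro: finite_subset[OF _ finite_paths])
    finally show ?thesis by simp
  qed
  have "mtrace (M * ?D) = (\<Sum>i<2^n. \<Sum>a<2^n. \<Sum>\<gamma>\<in>?T. ?c \<gamma> * (M $$ (i,a) * pmat n (\<gamma> ! L) $$ (a,i)))"
    unfolding mtrace_mult[OF M D]
    by (intro sum.cong refl) (simp add: entry sum_distrib_left ac_simps del: index_minus_mat)
  also have "\<dots> = (\<Sum>\<gamma>\<in>?T. ?c \<gamma> * mtrace (M * pmat n (\<gamma> ! L)))"
    unfolding mtrace_mult[OF M pmat_carrier] sum_distrib_left
    by (rule sum_swap3)
  finally have "cmod (mtrace (M * ?D)) \<le> (\<Sum>\<gamma>\<in>?T. cmod (?c \<gamma> * mtrace (M * pmat n (\<gamma> ! L))))"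
    by (simp only: norm_sum)
  also have "\<dots> \<le> (\<Sum>\<gamma>\<in>?T. \<bar>path_coef n \<tau> s G L \<gamma>\<bar> * (c * 2^n))"
  proof (intro sum_mono)
    fix \<gamma> assume "\<gamma> \<in> ?T"
    hence q: "\<gamma> ! L \<in> paulis n" by (auto intro: pauli_path_nth)
    \<comment> \<open>The identity is inserted as a Pauli string so that the columnwise bound
      applies with unit columns on both sides.\<close>
    have "cmod (mtrace (M * (pmat n (\<gamma> ! L) * mat_adjoint (pmat n pauli_id))))
      \<le> c * (\<Sum>j<2^n. vnorm (col (pmat n (\<gamma> ! L)) j) * vnorm (col (pmat n pauli_id) j))"
      by (rule mtrace_mult_adjoint_le[OF M pmat_carrier pmat_carrier c])
    moreover have "pauli_id \<in> paulis n" by (simp add: paulis_def pauli_id_def)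
    ultimately have "cmod (mtrace (M * pmat n (\<gamma> ! L))) \<le> c * 2^n"
      using q right_mult_one_mat[OF pmat_carrier, of n "\<gamma> ! L"]
      by (simp add: vnorm_col_pmat pmat_adjoint) (simp add: pmat_id)
    thus "cmod (?c \<gamma> * mtrace (M * pmat n (\<gamma> ! L))) \<le> \<bar>path_coef n \<tau> s G L \<gamma>\<bar> * (c * 2^n)"
      by (simp add: norm_mult mult_left_mono)
  qed
  finally show ?thesis by (simp add: sum_distrib_left sum_distrib_right ac_simps)
qed

text \<open>With \<open>D = A - A'\<close>, the difference of the normalised operators is
  \<open>D / Tr A' - (Tr D / (Tr A * Tr A')) A\<close>.\<close>
lemma mtrace_normalized_difference_le:
  assumes A: "A \<in> carrier_mat N N" and A': "A' \<in> carrier_mat N N" and M: "M \<in> carrier_mat N N"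
    and trA: "mtrace A = complex_of_real a" "a \<ge> m" and "m > 0" "\<delta> < 1" "c \<ge> 0"
    and MA: "cmod (mtrace (M * A)) \<le> c * a"
    and D: "cmod (mtrace (A - A')) \<le> m * \<delta>" and MD: "cmod (mtrace (M * (A - A'))) \<le> c * (m * \<delta>)"
  shows "cmod (mtrace (M * ((1 / mtrace A) \<cdot>\<^sub>m A - (1 / mtrace A') \<cdot>\<^sub>m A'))) \<le> c * (2 * \<delta> / (1 - \<delta>))"
proof -
  define u where "u = mtrace (M * A)"
  define d where "d = mtrace (M * (A - A'))"
  define T where "T = mtrace A'"
  define e where "e = mtrace (A - A')"
  have a: "a > 0" using assms by simp
  have T: "T = complex_of_real a - e"
    using mtrace_minus[OF A A'] trA by (simp add: T_def e_def)
  \<comment> \<open>Together with a >= m this keeps Tr A' away from 0, with modulus at least m (1 -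
    delta).\<close>
  have "a - m * \<delta> \<le> cmod T"
    using norm_triangle_ineq2[of "complex_of_real a" e] D a by (simp add: T e_def)
  hence T1: "m * (1 - \<delta>) \<le> cmod T" using trA(2) by (simp add: algebra_simps)
  moreover have "m * (1 - \<delta>) > 0" using assms by simp
  ultimately have T0: "cmod T > 0" by linarith
  have \<delta>: "m * \<delta> \<ge> 0" using D norm_ge_zero order_trans by blast
  have MMA: "M * A \<in> carrier_mat N N" and MMA': "M * A' \<in> carrier_mat N N"
    using M A A' by (auto intro: mult_carrier_mat)
  have ud: "mtrace (M * A') = u - d"
    unfolding u_def d_def mult_minus_distrib_mat[OF M A A'] mtrace_minus[OF MMA MMA'] by simp
  have "mtrace (M * ((1 / mtrace A) \<cdot>\<^sub>m A - (1 / T) \<cdot>\<^sub>m A')) = 1 / mtrace A * u - 1 / T * (u - d)"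
    unfolding mult_minus_distrib_mat[OF M smult_carrier_mat[OF A] smult_carrier_mat[OF A']]
      mult_smult_distrib[OF M A] mult_smult_distrib[OF M A']
      mtrace_minus[OF smult_carrier_mat[OF MMA] smult_carrier_mat[OF MMA']]
      mtrace_smult[OF MMA] mtrace_smult[OF MMA'] ud u_def[symmetric] ..
  also have "\<dots> = d / T - u * e / (complex_of_real a * T)"
    using T0 a unfolding trA(1) by (simp add: field_simps) (simp add: T algebra_simps)
  also have "cmod \<dots> \<le> cmod d / cmod T + cmod u * cmod e / (a * cmod T)"
    using norm_triangle_ineq4[of "d / T" "u * e / (complex_of_real a * T)"] a
    by (simp add: norm_divide norm_mult)
  also have "\<dots> \<le> c * (m * \<delta>) / cmod T + (c * a) * (m * \<delta>) / (a * cmod T)"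
    using MA MD D a T0 \<open>c \<ge> 0\<close> unfolding u_def d_def e_def
    by (intro add_mono divide_right_mono mult_mono) auto
  \<comment> \<open>The trace \<open>a\<close> cancels, so both error terms have the same size;
    below, \<open>m\<close> cancels as well and no dimension factor survives.\<close>
  also have "\<dots> = 2 * c * (m * \<delta>) / cmod T" using a by (simp add: field_simps)
  also have "\<dots> \<le> 2 * c * (m * \<delta>) / (m * (1 - \<delta>))"
    using T1 \<open>m * (1 - \<delta>) > 0\<close> \<delta> \<open>c \<ge> 0\<close>
    by (intro divide_left_mono mult_pos_pos[OF T0] mult_nonneg_nonneg[OF _ \<delta>]) auto
  also have "\<dots> = c * (2 * \<delta> / (1 - \<delta>))" using \<open>m > 0\<close> by simp
  finally show ?thesis by (simp add: T_def)
qed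

theorem mainTheorem8:
  fixes n L k :: nat and \<beta> \<Lambda> \<tau> \<epsilon> :: real
    and sg :: "nat \<Rightarrow> real" and G :: "nat \<Rightarrow> nat \<Rightarrow> nat"
    and \<rho> \<rho>' :: "complex mat"
  assumes n: "n \<ge> 1" and \<beta>: "\<beta> > 0" and \<Lambda>: "\<Lambda> > 0" and L: "L \<ge> 1"
    and \<tau>: "\<tau> = \<beta> * \<Lambda> / (2 * real L)"
    and sg: "\<forall>t\<in>{1..L}. sg t = 1 \<or> sg t = -1"
    and G: "\<forall>t\<in>{1..L}. G t \<in> paulis n \<and> G t \<noteq> pauli_id"
    and k: "real k > exp 1 * \<beta> * \<Lambda> / 2"
    and \<rho>: "\<rho> = (1 / mtrace (Aop n \<tau> sg G L)) \<cdot>\<^sub>m Aop n \<tau> sg G L"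
    and \<rho>': "\<rho>' = (1 / mtrace (Atrunc n \<tau> sg G L k)) \<cdot>\<^sub>m Atrunc n \<tau> sg G L k"
    and \<epsilon>: "\<epsilon> = exp (\<beta> * \<Lambda> / 2) * (exp 1 * \<beta> * \<Lambda> / (2 * real k)) ^ k"
    and \<epsilon>1: "\<epsilon> < 1"
  shows "trace_norm (\<rho> - \<rho>') \<le> 2 * \<epsilon> / (1 - \<epsilon>)
    \<and> (\<forall>Ob \<in> carrier_mat (2^n) (2^n). mat_adjoint Ob = Ob \<longrightarrow>
          cmod (mtrace (Ob * (\<rho> - \<rho>'))) \<le> op_norm Ob * (2 * \<epsilon> / (1 - \<epsilon>)))"
proof -
  let ?A = "Aop n \<tau> sg G L" and ?A' = "Atrunc n \<tau> sg G L k"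
  have x: "real L * \<tau> = \<beta> * \<Lambda> / 2" using L by (simp add: \<tau>)
  have \<tau>0: "\<tau> > 0" using \<beta> \<Lambda> L by (simp add: \<tau>)
  \<comment> \<open>Since e >= 1, the assumption on \<open>k\<close> implies k >= L tau, i.e. the
    Chernoff weight is at least 1.\<close>
  have "1 * (\<beta> * \<Lambda> / 2) \<le> exp 1 * (\<beta> * \<Lambda> / 2)" using \<beta> \<Lambda> by (intro mult_right_mono) auto
  hence kx: "real k \<ge> real L * \<tau>" using k x by simp
  define \<delta> where "\<delta> = (\<Sum>\<gamma> | pauli_path n sg G L \<gamma> \<and> path_r n sg G L \<gamma> > k. \<bar>path_coef n \<tau> sg G L \<gamma>\<bar>)"
  have "\<delta> \<le> (exp 1 * \<beta> * \<Lambda> / (2 * real k)) ^ k"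
    using path_tail_le[OF sg G \<tau>0 L kx] by (simp add: \<delta>_def x mult.assoc)
  \<comment> \<open>The factor exp (beta Lambda / 2) in \<open>\<epsilon>\<close> is at least
    1.\<close>
  also have "\<dots> = 1 * \<dots>" by simp
  also have "\<dots> \<le> \<epsilon>" unfolding \<epsilon> using \<beta> \<Lambda> by (intro mult_right_mono) auto
  finally have \<delta>\<epsilon>: "\<delta> \<le> \<epsilon>" .
  obtain V where V: "V \<in> carrier_mat (2^n) (2^n)" and AV: "?A = V * mat_adjoint V"
    and det: "det (V * mat_adjoint V) = 1" using Aop_gram[OF sg G] by blast
  define a where "a = (\<Sum>j<2^n. (vnorm (col V j))\<^sup>2)"
  have tr: "mtrace ?A = complex_of_real a" unfolding AV a_def by (rule mtrace_mult_adjoint_self[OF V])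
  have a: "a \<ge> 2^n" using mtrace_gram_ge_dim[OF V det] tr AV by simp
  \<comment> \<open>One estimate for both claims: contractions with \<open>c = 1\<close> yield the
    trace norm, observables with \<open>c = op_norm Ob\<close> the expectation values.\<close>
  have bound: "cmod (mtrace (M * (\<rho> - \<rho>'))) \<le> c * (2 * \<epsilon> / (1 - \<epsilon>))"
    if M: "M \<in> carrier_mat (2^n) (2^n)"
      and c: "\<And>v. v \<in> carrier_vec (2^n) \<Longrightarrow> vnorm (M *\<^sub>v v) \<le> c * vnorm v" for M c
    unfolding \<rho> \<rho>'
  proof (rule mtrace_normalized_difference_le[OF Aop_carrier Atrunc_carrier M tr a _ \<epsilon>1])
    \<comment> \<open>A unit vector to test the operator bound on, which forces c >= 0.\<close>
    let ?e = "col (pmat n pauli_id) 0"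
    have e: "?e \<in> carrier_vec (2^n)" by (rule carrier_vecI) simp
    have "vnorm ?e = 1" by (rule vnorm_col_pmat) (simp_all add: paulis_def pauli_id_def)
    thus c0: "c \<ge> 0" using order_trans[OF vnorm_nonneg c[OF e]] by simp
    show "cmod (mtrace (M * ?A)) \<le> c * a"
      using mtrace_mult_adjoint_le[OF M V V c] unfolding AV a_def by (simp add: power2_eq_square)
    show "cmod (mtrace (M * (?A - ?A'))) \<le> c * (2^n * \<epsilon>)"
      using mtrace_truncation_error_le[OF sg G M c, of \<tau> k] c0 \<delta>\<epsilon>
        mult_left_mono[OF \<delta>\<epsilon>, of "c * 2^n"] by (simp add: \<delta>_def mult.assoc)
    \<comment> \<open>Taking the identity as test matrix bounds the error in the normalising trace
      itself.\<close>
    have "cmod (mtrace (1\<^sub>m (2^n) * (?A - ?A'))) \<le> 1 * 2^n * \<delta>"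
      unfolding \<delta>_def by (rule mtrace_truncation_error_le[OF sg G one_carrier_mat]) simp
    hence "cmod (mtrace (?A - ?A')) \<le> 2^n * \<delta>"
      using left_mult_one_mat[OF minus_carrier_mat[OF Atrunc_carrier], of n ?A \<tau> sg G L k] by simp
    also have "\<dots> \<le> 2^n * \<epsilon>" by (rule mult_left_mono[OF \<delta>\<epsilon>]) simp
    finally show "cmod (mtrace (?A - ?A')) \<le> 2^n * \<epsilon>" .
  qed simp
  have R: "\<rho> - \<rho>' \<in> carrier_mat (2^n) (2^n)"
    unfolding \<rho>' by (rule minus_carrier_mat[OF smult_carrier_mat[OF Atrunc_carrier]])
  have "trace_norm (\<rho> - \<rho>') \<le> 2 * \<epsilon> / (1 - \<epsilon>)"
    by (rule trace_norm_le[OF R]) (use bound[where c = 1] in auto)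
  moreover have "cmod (mtrace (Ob * (\<rho> - \<rho>'))) \<le> op_norm Ob * (2 * \<epsilon> / (1 - \<epsilon>))"
    if "Ob \<in> carrier_mat (2^n) (2^n)" for Ob
    by (rule bound[OF that vnorm_mult_le_op_norm[OF that]])
  ultimately show ?thesis by blast
qed

end
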